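(* Let $\ell$ be a prime and let $G$ be a subgroup of $\mathrm{Sp}_4(\mathbb{F}_\ell)$ containing a transvection. Assume moreover that $G$ contains two elements whose characteristic polynomials $P_1(X)$, $P_2(X)$ satisfy the following, where the four roots (in $\overline{\mathbb{F}}_\ell$) of $P_i(X)$ are written $\alpha_i,1/\alpha_i,\beta_i,1/\beta_i$ for $i=1,2$: (a) $\alpha_1+1/\alpha_1\notin\mathbb{F}_\ell$, $\beta_1+1/\beta_1\notin\mathbb{F}_\ell$, and $\alpha_1+1/\alpha_1+\beta_1+1/\beta_1\neq 0$; (b) $\alpha_2+1/\alpha_2\in\mathbb{F}_\ell$, $\beta_2+1/\beta_2\in\mathbb{F}_\ell$, $\Delta_0(P_2)\neq 0$ and $\alpha_2\notin\mathbb{F}_\ell$. Then $G=\mathrm{Sp}_4(\mathbb{F}_\ell)$.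
   Context: The characteristic polynomial of any element of $\mathrm{Sp}_4(\mathbb{F}_\ell)$ has the form $P(X)=X^4+aX^3+bX^2+aX+1$ with $a,b\in\mathbb{F}_\ell$, and its roots can be written $\alpha,1/\alpha,\beta,1/\beta$. For such $P$, $\Delta_0(P)=a^2-4b+8\in\mathbb{F}_\ell$. A transvection is a non-identity element $t$ such that $t-\mathrm{Id}$ has rank $1$.
   Formalization: The prime ℓ = 2 is excluded, because the claim fails there: S_5 (the minus-type orthogonal group) is a proper subgroup of Sp_4(F_2) that contains a transvection and elements satisfying (a) and (b). All odd primes are covered. *)

theory Defs
  imports
    "HOL-Algebra.Algebraic_Closure_Type"
    "Jordan_Normal_Form.Char_Poly"
    "Jordan_Normal_Form.DL_Rank"
    "Berlekamp_Zassenhaus.Finite_Field"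
begin

definition symplectic_form_mat :: "'a :: comm_ring_1 mat" where
  "symplectic_form_mat = four_block_mat (0\<^sub>m 2 2) (1\<^sub>m 2) (- 1\<^sub>m 2) (0\<^sub>m 2 2)"

text \<open>Here \<open>\<bbbF>\<^sub>l\<close> will be \<open>'l mod_ring\<close>, the integers modulo \<open>l = CARD('l)\<close>, where \<open>'l\<close> is of
  class \<open>prime_card\<close>, that is, \<open>CARD('l)\<close> is an arbitrary prime.\<close>

definition Sp4 :: "'a :: comm_ring_1 mat monoid" where
  "Sp4 = \<lparr>carrier = {A \<in> carrier_mat 4 4. A\<^sup>T * symplectic_form_mat * A = symplectic_form_mat},
          monoid.mult = (*), one = 1\<^sub>m 4\<rparr>"

definition transvection :: "'a :: field mat \<Rightarrow> bool" where
  "transvection t \<longleftrightarrow> t \<noteq> 1\<^sub>m 4 \<and> vec_space.rank 4 (t - 1\<^sub>m 4) = 1"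

text \<open>For \<open>P = X\<^sup>4 + a X\<^sup>3 + b X\<^sup>2 + a X + 1\<close> this is \<open>a\<^sup>2 - 4 b + 8\<close>.\<close>

definition Delta0 :: "'a :: comm_ring_1 poly \<Rightarrow> 'a" where
  "Delta0 P = (coeff P 3)\<^sup>2 - 4 * coeff P 2 + 8"

text \<open>The four roots, with multiplicity, of a quartic \<open>P\<close> in the algebraic closure of its
  coefficient field are \<open>\<alpha>\<close>, \<open>1 / \<alpha>\<close>, \<open>\<beta>\<close>, \<open>1 / \<beta>\<close>.\<close>

definition reciprocal_roots :: "'a :: field poly \<Rightarrow> 'a alg_closure \<Rightarrow> 'a alg_closure \<Rightarrow> bool" where
  "reciprocal_roots P \<alpha> \<beta> \<longleftrightarrow> proots (map_poly to_ac P) = {#\<alpha>, 1 / \<alpha>, \<beta>, 1 / \<beta>#}"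

text \<open>
  The theorem is stated for primes \<open>l \<noteq> 2\<close> because it fails for \<open>l = 2\<close>. There, the orthogonal group
  of the quadratic form \<open>x\<^sub>1 x\<^sub>3 + x\<^sub>2\<^sup>2 + x\<^sub>2 x\<^sub>4 + x\<^sub>4\<^sup>2\<close> is a subgroup of order 120 of the symplectic
  group, which has order 720. It contains transvections, elements with characteristic polynomial
  \<open>X\<^sup>4 + X\<^sup>3 + X\<^sup>2 + X + 1\<close>, which satisfy the hypotheses on \<open>g1\<close>, and elements with
  characteristic polynomial \<open>(X\<^sup>2 + X + 1) (X + 1)\<^sup>2\<close>, which satisfy the hypotheses on \<open>g2\<close>.
\<close>

end

theory Submission
  imports Defs "HOL-Library.Product_Plus"
begin

unbundle no fps_syntax

text \<open>
  Call a nonzero vector a center if all transvections along it lie in \<open>G\<close>. Over a prime field,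
  with two non-orthogonal centers every nonzero vector of their plane is a center. For a symplectic
  \<open>g\<close> the map \<open>A = g + g\<^sup>-\<^sup>1\<close> is self-adjoint and alternating, that is \<open>\<langle>A x, x\<rangle> = 0\<close>, and it
  satisfies the quadratic equation whose roots are \<open>\<alpha> + 1/\<alpha>\<close> and \<open>\<beta> + 1/\<beta>\<close>. For \<open>g\<^sub>1\<close> it has no
  eigenvalue in \<open>\<bbbF>\<^sub>l\<close>, so a proper invariant subspace must be a totally isotropic plane; \<open>g\<^sub>2\<close>
  excludes these, because it splits the space into two orthogonal planes, one of them without
  eigenvectors. Hence no nonzero vector is orthogonal to all centers. If the centers lay in the
  union of a hyperbolic plane and its complement, \<open>g\<^sub>1\<close> would preserve the plane, giving \<open>A\<close> an
  eigenvector, or swap it with its complement, giving \<open>A\<close> trace zero. Otherwise all nonzero vectors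
  turn out to be centers, and transvections generate the symplectic group.
\<close>

section \<open>Symplectic spaces of dimension four\<close>

definition pfaffian :: "('v \<Rightarrow> 'v \<Rightarrow> 'f::comm_ring_1) \<Rightarrow> 'v \<Rightarrow> 'v \<Rightarrow> 'v \<Rightarrow> 'v \<Rightarrow> 'f" where
  "pfaffian B x y z w = B x y * B z w - B x z * B y w + B x w * B y z"

text \<open>On a four-dimensional symplectic space \<open>pfaffian\<close> is the determinant with respect to a
  symplectic basis up to sign. Cramer's rule for it encodes that the dimension is at most four.\<close>

locale symplectic_space4 = vector_space scale
  for scale :: "'f::field \<Rightarrow> 'v::ab_group_add \<Rightarrow> 'v" (infixr \<open>*s\<close> 75) +
  fixes B :: "'v \<Rightarrow> 'v \<Rightarrow> 'f"
  assumes B_add_left: "B (x + y) z = B x z + B y z"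
    and B_add_right: "B z (x + y) = B z x + B z y"
    and B_scale_left: "B (c *s x) z = c * B x z"
    and B_self [simp]: "B x x = 0"
    and nondegenerate: "x \<noteq> 0 \<Longrightarrow> \<exists>y. B x y \<noteq> 0"
    and cramer: "pfaffian B x y z w *s u =
      pfaffian B u y z w *s x + pfaffian B x u z w *s y + pfaffian B x y u w *s z + pfaffian B x y z u *s w"
    and two_neq_0: "(2::'f) \<noteq> 0"
begin

lemma B_skew: "B y x = - B x y"
  using B_self[of "x + y"] unfolding B_add_left B_add_right
  by (simp add: eq_neg_iff_add_eq_0 add.commute)

lemma B_scale_right: "B z (c *s x) = c * B z x"
  using B_skew[of z "c *s x"] B_skew[of z x] by (simp add: B_scale_left)

lemma B_zero_left [simp]: "B 0 z = 0"
  using B_scale_left[of 0 0 z] by simp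

lemma B_zero_right [simp]: "B z 0 = 0"
  using B_skew[of z 0] by simp

lemma B_minus_left: "B (- x) z = - B x z"
  using B_scale_left[of "-1" x z] by simp

lemma B_minus_right: "B z (- x) = - B z x"
  using B_scale_right[of z "-1" x] by simp

lemma B_diff_left: "B (x - y) z = B x z - B y z"
  using B_add_left[of x "-y" z] by (simp add: B_minus_left)

lemma B_diff_right: "B z (x - y) = B z x - B z y"
  using B_add_right[of z x "-y"] by (simp add: B_minus_right)

lemmas B_simps = B_add_left B_add_right B_scale_left B_scale_right B_minus_left B_minus_right
  B_diff_left B_diff_right

lemma B_eq_0_commute: "B x y = 0 \<longleftrightarrow> B y x = 0"
  using B_skew[of x y] by simp

text \<open>A totally isotropic plane is its own orthogonal complement. Once \<open>x\<close>,
  \<open>y\<close> are completed to four vectors with nonzero \<open>pfaffian\<close>, Cramer's rule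
  applies to \<open>z\<close>, and orthogonality kills the coefficients of the two added
  vectors.\<close>

lemma in_isotropic_plane:
  assumes x: "x \<noteq> 0" and y: "\<And>c. y \<noteq> c *s x"
    and "B x y = 0" "B x z = 0" "B y z = 0"
  shows "\<exists>a b. z = a *s x + b *s y"
proof -
  obtain w where w: "B x w \<noteq> 0" using nondegenerate[OF x] by blast
  \<comment> \<open>The subtraction makes this vector orthogonal to \<open>w\<close>; the
    \<open>pfaffian\<close> of \<open>x\<close>, \<open>y\<close>, \<open>w\<close>,
    \<open>w'\<close> is then \<open>- B x w\<close> times its pairing with
    \<open>w'\<close>.\<close>
  have "y - (B y w / B x w) *s x \<noteq> 0" using y by auto
  then obtain w' where "B (y - (B y w / B x w) *s x) w' \<noteq> 0" using nondegenerate by blast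
  then have D: "pfaffian B x y w w' \<noteq> 0" (is "?D \<noteq> 0")
    using w assms(3) by (simp add: pfaffian_def B_simps field_simps)
  have "?D *s z = pfaffian B z y w w' *s x + pfaffian B x z w w' *s y"
    using cramer[of x y w w' z] assms(3-5) B_eq_0_commute[of x z] B_eq_0_commute[of y z]
    by (simp add: pfaffian_def)
  then have "z = (1 / ?D) *s (pfaffian B z y w w' *s x + pfaffian B x z w w' *s y)"
    using D by (metis scale_scale scale_one divide_self_if times_divide_eq_left mult_1)
  then have "z = (1 / ?D * pfaffian B z y w w') *s x + (1 / ?D * pfaffian B x z w w') *s y"
    by (simp add: scale_right_distrib)
  then show ?thesis by blast
qed

text \<open>Cramer's rule again: the \<open>pfaffian\<close> of two orthogonal hyperbolic pairs is
  \<open>B v w * B r s\<close>, so the pairs form a basis.\<close>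

lemma hyperbolic_decomposition:
  assumes vw: "B v w \<noteq> 0" and rs: "B r s \<noteq> 0"
    and "B v r = 0" "B w r = 0" "B v s = 0" "B w s = 0"
  shows "z = (B z w / B v w) *s v + (B v z / B v w) *s w + (B z s / B r s) *s r + (B r z / B r s) *s s"
    (is "z = ?z")
proof -
  have "(B v w * B r s) *s z = (B v w * B r s) *s ?z"
    using cramer[of v w r s z] assms by (simp add: pfaffian_def algebra_simps)
  then show ?thesis using vw rs by simp
qed

lemma orthogonal_to_hyperbolic_pairs:
  assumes "B v w \<noteq> 0" "B r s \<noteq> 0" "B v r = 0" "B w r = 0" "B v s = 0" "B w s = 0"
    and "B z v = 0" "B z w = 0" "B z r = 0" "B z s = 0"
  shows "z = 0"
  using hyperbolic_decomposition[OF assms(1-6), of z] assms(7-10)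
    B_eq_0_commute[of z v] B_eq_0_commute[of z r] by simp

lemma hyperbolic_split:
  assumes "B v w \<noteq> 0"
  obtains a b k where "z = a *s v + b *s w + k" "B v k = 0" "B w k = 0"
proof
  define k where "k = z - ((B z w / B v w) *s v + (B v z / B v w) *s w)"
  show "z = (B z w / B v w) *s v + (B v z / B v w) *s w + k" by (simp add: k_def)
  show "B v k = 0" "B w k = 0"
    using assms B_skew[of w z] B_skew[of w v] by (simp_all add: k_def B_simps field_simps)
qed

lemma hyperbolic_plane_pairing:
  assumes "B v w \<noteq> 0" "a *s v + b *s w \<noteq> 0"
  shows "\<exists>p\<in>{v, w}. B (a *s v + b *s w) p \<noteq> 0"
  using assms B_skew[of w v] by (cases "a = 0") (auto simp: B_simps)

text \<open>One of \<open>p\<close>, \<open>q\<close>, \<open>p + q\<close> always works. This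
  stands in for the fact that a vector space is not the union of two proper subspaces.\<close>

lemma common_pairing:
  assumes "B x p \<noteq> 0" "B y q \<noteq> 0" "p \<in> U" "q \<in> U" "p + q \<in> U"
  shows "\<exists>z\<in>U. B x z \<noteq> 0 \<and> B y z \<noteq> 0"
proof (cases "B y p = 0 \<and> B x q = 0")
  case True
  then have "B x (p + q) \<noteq> 0 \<and> B y (p + q) \<noteq> 0" using assms by (simp add: B_simps)
  then show ?thesis using assms by blast
qed (use assms in blast)

definition transvec :: "'v \<Rightarrow> 'f \<Rightarrow> 'v \<Rightarrow> 'v" where
  "transvec v c x = x + (c * B x v) *s v"

definition isometry :: "('v \<Rightarrow> 'v) \<Rightarrow> bool" where
  "isometry f \<longleftrightarrow> (\<forall>x y. f (x + y) = f x + f y) \<and> (\<forall>c x. f (c *s x) = c *s f x) \<and>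
    (\<forall>x y. B (f x) (f y) = B x y)"

lemma isometryD:
  assumes "isometry f"
  shows "f (x + y) = f x + f y" "f (c *s x) = c *s f x" "B (f x) (f y) = B x y"
  using assms by (simp_all add: isometry_def)

lemma isometry_zero: "isometry f \<Longrightarrow> f 0 = 0"
  using isometryD(2)[of f 0 0] by simp

end

section \<open>Groups of isometries and their transvections\<close>

locale isometry_group = symplectic_space4 +
  fixes G :: "('b \<Rightarrow> 'b) set"
  assumes isometryG: "g \<in> G \<Longrightarrow> isometry g"
    and id_in_G: "id \<in> G"
    and comp_in_G: "g \<in> G \<Longrightarrow> h \<in> G \<Longrightarrow> g \<circ> h \<in> G"
    and inv_in_G: "g \<in> G \<Longrightarrow> \<exists>h\<in>G. \<forall>x. h (g x) = x \<and> g (h x) = x"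
begin

section \<open>Vectors whose full transvection group lies in \<open>G\<close>\<close>

definition centers :: "'b set" where
  "centers = {v. v \<noteq> 0 \<and> (\<forall>c. transvec v c \<in> G)}"

lemma centers_scale:
  assumes "v \<in> centers" "a \<noteq> 0"
  shows "a *s v \<in> centers"
proof -
  have "transvec (a *s v) c = transvec v (c * a * a)" for c
    by (rule ext) (simp add: transvec_def B_simps mult_ac)
  then show ?thesis using assms by (simp add: centers_def)
qed

text \<open>Conjugating the transvections along \<open>v\<close> by \<open>g\<close> gives those
  along \<open>g v\<close>.\<close>

lemma centers_image:
  assumes v: "v \<in> centers" and g: "g \<in> G"
  shows "g v \<in> centers"
proof -
  obtain h where h: "h \<in> G" "\<And>x. h (g x) = x" "\<And>x. g (h x) = x" using inv_in_G[OF g] by blast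
  note iso = isometryD[OF isometryG[OF g]]
  have "transvec (g v) c = g \<circ> transvec v c \<circ> h" for c
  proof
    fix x
    have "B x (g v) = B (h x) v" using iso(3)[of "h x" v] h(3) by simp
    then show "transvec (g v) c x = (g \<circ> transvec v c \<circ> h) x"
      by (simp add: transvec_def iso h(3))
  qed
  moreover have "g v \<noteq> 0" using v h(2)[of v] isometry_zero[OF isometryG[OF h(1)]] by (auto simp: centers_def)
  ultimately show ?thesis using v g h(1) by (simp add: centers_def comp_in_G)
qed

text \<open>A center carries its whole transvection group, so scaling and one application of a
  transvection already sweep out the plane; generation of \<open>SL\<^sub>2\<close> is not needed.\<close>

lemma centers_plane:
  assumes v: "v \<in> centers" and w: "w \<in> centers" and vw: "B v w \<noteq> 0" and ab: "a *s v + b *s w \<noteq> 0"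
  shows "a *s v + b *s w \<in> centers"
proof (cases "b = 0")
  case True
  then show ?thesis using ab centers_scale[OF v, of a] by auto
next
  case False
  define c where "c = a / b / B w v"
  have wv: "B w v \<noteq> 0" using vw B_skew[of w v] by simp
  have "transvec v c \<in> G" using v by (simp add: centers_def)
  then have "b *s transvec v c w \<in> centers" using centers_scale[OF centers_image[OF w]] False by blast
  moreover have "b *s transvec v c w = a *s v + b *s w"
    using False wv by (simp add: transvec_def c_def scale_right_distrib add.commute)
  ultimately show ?thesis by simp
qed

lemma centers_add: "v \<in> centers \<Longrightarrow> w \<in> centers \<Longrightarrow> B v w \<noteq> 0 \<Longrightarrow> v + w \<in> centers"
  using centers_plane[of v w 1 1] B_minus_left[of w w] by (fastforce simp: add_eq_0_iff)

text \<open>When \<open>B h y \<noteq> 0\<close>, the difference \<open>y - h\<close> is a center,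
  and its pairing with \<open>k + h\<close> is \<open>B h y\<close> up to sign, so the sum
  \<open>k + y\<close> is a center. When \<open>h\<close> and \<open>y\<close> are orthogonal, the
  passage goes through a vector \<open>x\<close> of the plane that pairs with both.\<close>

lemma centers_shift:
  assumes v: "v \<in> centers" and w: "w \<in> centers" and vw: "B v w \<noteq> 0"
    and k: "B v k = 0" "B w k = 0"
    and h: "h = a *s v + b *s w" "h \<noteq> 0" "k + h \<in> centers"
    and y: "y = c *s v + d *s w" "y \<noteq> 0"
  shows "k + y \<in> centers"
proof -
  have step: "k + y \<in> centers" if "h = a *s v + b *s w" "k + h \<in> centers" "y = c *s v + d *s w" "B h y \<noteq> 0"
    for h a b y c d
  proof -
    have "y - h = (c - a) *s v + (d - b) *s w" using that by (simp add: algebra_simps)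
    moreover have "y - h \<noteq> 0" using that(4) by auto
    ultimately have "y - h \<in> centers" using centers_plane[OF v w vw] by metis
    moreover have "B k h = 0" "B k y = 0"
      using that(1,3) k B_skew[of k v] B_skew[of k w] by (simp_all add: B_simps)
    then have "B (k + h) (y - h) \<noteq> 0"
      using that(4) by (simp add: B_add_left B_diff_right)
    ultimately have "(k + h) + (y - h) \<in> centers" using that(2) centers_add by blast
    then show ?thesis by simp
  qed
  define U where "U = {e *s v + f *s w | e f. True}"
  have "1 *s v + 0 *s w \<in> U" "0 *s v + 1 *s w \<in> U" unfolding U_def by blast+
  then have vwU: "v \<in> U" "w \<in> U" by simp_all
  have U_add: "p + q \<in> U" if "p \<in> U" "q \<in> U" for p q
  proof -
    obtain e f e' f' where "p = e *s v + f *s w" "q = e' *s v + f' *s w" using \<open>p \<in> U\<close> \<open>q \<in> U\<close> U_def by blast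
    then have "p + q = (e + e') *s v + (f + f') *s w" by (simp add: algebra_simps)
    then show ?thesis unfolding U_def by blast
  qed
  obtain p where p: "p \<in> {v, w}" "B h p \<noteq> 0" using hyperbolic_plane_pairing[OF vw] h(1,2) by blast
  obtain q where q: "q \<in> {v, w}" "B y q \<noteq> 0" using hyperbolic_plane_pairing[OF vw] y by blast
  have "p \<in> U" "q \<in> U" using p q vwU by auto
  then obtain x where x: "x \<in> U" "B h x \<noteq> 0" "B y x \<noteq> 0"
    using common_pairing[OF p(2) q(2)] U_add by blast
  then obtain e f where ef: "x = e *s v + f *s w" unfolding U_def by blast
  have "k + x \<in> centers" using step[OF h(1,3) ef x(2)] .
  then show ?thesis using step[OF ef _ y(1)] x(3) B_eq_0_commute by blast
qed

text \<open>Some center \<open>u\<close> pairs with \<open>k\<close>; let \<open>m\<close> be its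
  component orthogonal to \<open>v\<close> and \<open>w\<close>. If the other component is nonzero,
  it can be replaced by \<open>- v\<close>, and adding the center \<open>k + v\<close> gives
  \<open>k + m\<close>, which lies in the complement and still pairs with \<open>k\<close>.\<close>

lemma centers_complement_vector:
  assumes v: "v \<in> centers" and w: "w \<in> centers" and vw: "B v w \<noteq> 0"
    and k: "B v k = 0" "B w k = 0" "k \<noteq> 0"
    and shift: "\<And>a b. a *s v + b *s w \<noteq> 0 \<Longrightarrow> k + (a *s v + b *s w) \<in> centers"
    and radical: "\<And>x. x \<noteq> 0 \<Longrightarrow> \<exists>s\<in>centers. B x s \<noteq> 0"
  obtains m where "m \<in> centers" "B v m = 0" "B w m = 0" "B k m \<noteq> 0"
proof -
  have v0: "v \<noteq> 0" using v by (simp add: centers_def)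
  obtain u where u: "u \<in> centers" "B k u \<noteq> 0" using radical[OF k(3)] by blast
  obtain a b m where m: "u = a *s v + b *s w + m" "B v m = 0" "B w m = 0"
    using hyperbolic_split[OF vw, of u] by blast
  note skew = B_skew[of k v] B_skew[of k w] B_skew[of m v] B_skew[of m w]
  have km: "B k m \<noteq> 0" using u(2) k skew by (simp add: m(1) B_simps)
  show ?thesis
  proof (cases "a *s v + b *s w = 0")
    case True
    then show ?thesis using that[of m] u(1) m km by simp
  next
    case False
    have "m + (a *s v + b *s w) \<in> centers" using u(1) m(1) by (simp add: add.commute)
    then have "m + (- v) \<in> centers"
      using centers_shift[OF v w vw m(2,3) refl False _, of "- v" "-1" 0] v0 by simp
    moreover have "k + v \<in> centers" using shift[of 1 0] v0 by simp
    moreover have "B (k + v) (m + (- v)) = B k m" using m k skew by (simp add: B_simps)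
    ultimately have "(k + v) + (m + (- v)) \<in> centers" using centers_add km by metis
    then have "k + m \<in> centers" by (simp add: algebra_simps)
    moreover have "B k (k + m) \<noteq> 0" using km by (simp add: B_simps)
    ultimately show ?thesis using that[of "k + m"] k m by (simp add: B_simps)
  qed
qed

text \<open>The sum of \<open>k + v\<close>, \<open>m\<close> and \<open>k - v\<close> is the center
  \<open>2 *s k + m\<close>. It spans a hyperbolic plane with \<open>m\<close>, and this plane
  contains \<open>k\<close> because 2 is invertible.\<close>

lemma centers_complement:
  assumes v: "v \<in> centers" and w: "w \<in> centers" and vw: "B v w \<noteq> 0"
    and k: "B v k = 0" "B w k = 0"
    and shift: "\<And>a b. a *s v + b *s w \<noteq> 0 \<Longrightarrow> k + (a *s v + b *s w) \<in> centers"
    and m: "m \<in> centers" "B v m = 0" "B w m = 0" "B k m \<noteq> 0"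
  shows "k \<in> centers"
proof -
  have v0: "v \<noteq> 0" using v by (simp add: centers_def)
  note skew = B_skew[of k v] B_skew[of k w] B_skew[of m v] B_skew[of m w] B_skew[of m k]
  have "k + v \<in> centers" using shift[of 1 0] v0 by simp
  then have "(k + v) + m \<in> centers" using centers_add[OF _ m(1)] m by (simp add: B_simps)
  moreover have "k + (- v) \<in> centers" using shift[of "-1" 0] v0 by simp
  moreover have "B ((k + v) + m) (k + (- v)) \<noteq> 0" using m k skew by (simp add: B_simps)
  ultimately have "((k + v) + m) + (k + (- v)) \<in> centers" using centers_add by metis
  moreover have "((k + v) + m) + (k + (- v)) = (k + k) + m" by (simp add: algebra_simps)
  moreover have "k + k = 2 *s k" using scale_left_distrib[of 1 1 k] by simp
  ultimately have km: "2 *s k + m \<in> centers" by metis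
  have k_eq: "(1 / 2) *s (2 *s k + m) + (- 1 / 2) *s m = k"
    using two_neq_0 by (simp add: scale_right_distrib)
  have "k \<noteq> 0" using m(4) by auto
  then show ?thesis
    using centers_plane[OF km m(1), of "1 / 2" "- 1 / 2"] k_eq m(4) two_neq_0 by (simp add: B_simps)
qed

text \<open>The center \<open>u\<close> lies neither in the plane of \<open>v\<close>,
  \<open>w\<close> nor in its complement, so both of its components are nonzero. Its component
  \<open>k\<close> in the complement turns out to be a center and has a partner \<open>m\<close>,
  which gives two orthogonal hyperbolic pairs of centers.\<close>

lemma centers_everything:
  assumes v: "v \<in> centers" and w: "w \<in> centers" and vw: "B v w \<noteq> 0"
    and radical: "\<And>x. x \<noteq> 0 \<Longrightarrow> \<exists>s\<in>centers. B x s \<noteq> 0"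
    and u: "u \<in> centers" "\<And>a b. u \<noteq> a *s v + b *s w" "B v u \<noteq> 0 \<or> B w u \<noteq> 0"
    and z: "z \<noteq> 0"
  shows "z \<in> centers"
proof -
  have v0: "v \<noteq> 0" using v by (simp add: centers_def)
  obtain a b k where k: "u = a *s v + b *s w + k" "B v k = 0" "B w k = 0"
    using hyperbolic_split[OF vw, of u] by blast
  have k0: "k \<noteq> 0" using u(2)[of a b] k(1) by auto
  have "a *s v + b *s w \<noteq> 0" using u(3) k by auto
  moreover have "k + (a *s v + b *s w) \<in> centers" using u(1) k(1) by (simp add: add.commute)
  ultimately have shift: "k + (c *s v + d *s w) \<in> centers" if "c *s v + d *s w \<noteq> 0" for c d
    using centers_shift[OF v w vw k(2,3) refl _ _ refl that] by blast
  obtain m where m: "m \<in> centers" "B v m = 0" "B w m = 0" "B k m \<noteq> 0"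
    using centers_complement_vector[OF v w vw k(2,3) k0 shift radical] by blast
  have kS: "k \<in> centers" by (rule centers_complement[OF v w vw k(2,3) shift m])
  obtain a b c d where z_eq: "z = a *s v + b *s w + (c *s k + d *s m)"
    using hyperbolic_decomposition[OF vw m(4) k(2,3) m(2,3), of z] unfolding add.assoc by blast
  let ?y = "a *s v + b *s w" and ?x = "c *s k + d *s m"
  show ?thesis
  proof (cases "?y = 0 \<or> ?x = 0")
    case True
    then have "z = ?y \<or> z = ?x" using z_eq by force
    then show ?thesis using z centers_plane[OF v w vw, of a b] centers_plane[OF kS m(1,4), of c d] by blast
  next
    case False
    \<comment> \<open>The center \<open>v + k\<close> has both components nonzero. They are replaced
      one at a time by those of \<open>z\<close>: first \<open>k\<close> by \<open>?x\<close>, then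
      \<open>v\<close> by \<open>?y\<close>.\<close>
    have "v + k \<in> centers" using shift[of 1 0] v0 by (simp add: add.commute)
    moreover have "B k v = 0" "B m v = 0" using k(2) m(2) B_eq_0_commute by blast+
    ultimately have "v + ?x \<in> centers"
      using centers_shift[OF kS m(1,4), of v k 1 0 ?x c d] False k0 by simp
    moreover have "B v ?x = 0" "B w ?x = 0" using k m by (simp_all add: B_simps)
    ultimately have "?x + ?y \<in> centers"
      using centers_shift[OF v w vw, of ?x v 1 0 ?y a b] False v0 by (simp add: add.commute)
    then show ?thesis by (simp add: z_eq add.commute)
  qed
qed

section \<open>Adjoints of isometries and the map \<open>g + h\<close> for \<open>h\<close> inverse
  to \<open>g\<close>\<close>

lemma adjoint:
  assumes g: "g \<in> G" and hg: "\<And>x. h (g x) = x" and gh: "\<And>x. g (h x) = x"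
  shows "B (g x) y = B x (h y)" "B (h x) y = B x (g y)" "isometry h"
proof -
  note iso = isometryD[OF isometryG[OF g]]
  show adj: "B (g x) y = B x (h y)" for x y using iso(3)[of x "h y"] gh by simp
  show "B (h x) y = B x (g y)" using iso(3)[of "h x" y] gh by simp
  obtain h' where h': "h' \<in> G" "\<And>x. h' (g x) = x" using inv_in_G[OF g] by blast
  have "h = h'" using h'(2) gh by (metis ext)
  then show "isometry h" using h'(1) isometryG by simp
qed

lemma sum_inverse_selfadjoint:
  assumes g: "g \<in> G" and hg: "\<And>x. h (g x) = x" and gh: "\<And>x. g (h x) = x"
  shows "B (g x + h x) y = B x (g y + h y)"
  using adjoint[OF assms] by (simp add: B_simps)

text \<open>Self-adjointness and skew-symmetry give \<open>B (A x) x = - B (A x) x\<close> for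
  \<open>A = g + h\<close>, and 2 is invertible.\<close>

lemma sum_inverse_alternating:
  assumes g: "g \<in> G" and hg: "\<And>x. h (g x) = x" and gh: "\<And>x. g (h x) = x"
  shows "B (g x + h x) x = 0"
proof -
  have "B (g x + h x) x = - B (g x + h x) x"
    using sum_inverse_selfadjoint[OF assms] B_skew by metis
  then have "2 * B (g x + h x) x = 0" by (metis mult_2 eq_neg_iff_add_eq_0)
  then show ?thesis using two_neq_0 by simp
qed

text \<open>Suppose the space \<open>R\<close> of vectors orthogonal to all centers is nonzero. It
  is stable under \<open>A\<close>, \<open>A'\<close> and \<open>g2\<close>, and \<open>g1\<close>
  forces it to be a totally isotropic plane equal to its own orthogonal complement. The two
  eigenspaces of \<open>A'\<close> are orthogonal to each other, and \<open>R\<close> can neither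
  lie inside one of them nor meet both.\<close>

lemma centers_complement_trivial:
  assumes centers_ne: "centers \<noteq> {}"
    and g1: "g1 \<in> G" "\<And>x. h1 (g1 x) = x" "\<And>x. g1 (h1 x) = x"
    and no_ev1: "\<And>x m. g1 x + h1 x = m *s x \<Longrightarrow> x = 0"
    and g2: "g2 \<in> G" "\<And>x. h2 (g2 x) = x" "\<And>x. g2 (h2 x) = x"
    and quad2: "\<And>x. (let A = \<lambda>x. g2 x + h2 x in A (A x) = (s + s') *s A x - (s * s') *s x)"
    and s: "s \<noteq> s'"
    and e: "e \<noteq> 0" "g2 e + h2 e = s *s e" and f: "f \<noteq> 0" "g2 f + h2 f = s' *s f"
    and no_ev2: "\<And>x m. g2 x + h2 x = s *s x \<Longrightarrow> g2 x = m *s x \<Longrightarrow> x = 0"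
    and x: "x \<noteq> 0"
  shows "\<exists>s\<in>centers. B x s \<noteq> 0"
proof (rule ccontr)
  define A where "A = (\<lambda>x. g1 x + h1 x)"
  define A' where "A' = (\<lambda>x. g2 x + h2 x)"
  define R where "R = {x. \<forall>s\<in>centers. B x s = 0}"
  assume "\<not> ?thesis"
  then have xR: "x \<in> R" by (simp add: R_def)
  note adj1 = adjoint[OF g1] and adj2 = adjoint[OF g2]
  have A_sa: "B (A x) y = B x (A y)" for x y unfolding A_def by (rule sum_inverse_selfadjoint[OF g1])
  have A'_sa: "B (A' x) y = B x (A' y)" for x y unfolding A'_def by (rule sum_inverse_selfadjoint[OF g2])
  have A_alt: "B (A x) x = 0" for x unfolding A_def by (rule sum_inverse_alternating[OF g1])
  note iso = isometryD[OF isometryG[OF g1(1)]] isometryD[OF isometryG[OF g2(1)]]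
    isometryD[OF adj1(3)] isometryD[OF adj2(3)]
  have "\<exists>h\<in>G. \<forall>x. h x = h1 x" using inv_in_G[OF g1(1)] g1(2,3) by metis
  then have h1: "h1 \<in> G" by (metis ext)
  have "\<exists>h\<in>G. \<forall>x. h x = h2 x" using inv_in_G[OF g2(1)] g2(2,3) by metis
  then have h2: "h2 \<in> G" by (metis ext)
  have R_add: "x + y \<in> R" if "x \<in> R" "y \<in> R" for x y using that by (simp add: R_def B_simps)
  have R_scale: "c *s x \<in> R" if "x \<in> R" for x c using that by (simp add: R_def B_simps)
  have R_g: "g2 x \<in> R" "A x \<in> R" "A' x \<in> R" if "x \<in> R" for x
  proof -
    have "B (g1 x) s = 0" "B (h1 x) s = 0" "B (g2 x) s = 0" "B (h2 x) s = 0" if "s \<in> centers" for s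
      using adj1(1,2)[of x s] adj2(1,2)[of x s] \<open>x \<in> R\<close> that centers_image g1(1) g2(1) h1 h2
      unfolding R_def by auto
    then show "g2 x \<in> R" "A x \<in> R" "A' x \<in> R" by (simp_all add: R_def A_def A'_def B_simps)
  qed
  \<comment> \<open>\<open>x\<close> and \<open>A x\<close> are independent because \<open>A\<close>
    has no eigenvector, and orthogonal because \<open>A\<close> is alternating. A center is
    orthogonal to both, so it lies in their span, hence in \<open>R\<close>.\<close>
  have SR: "v \<in> R" if v: "v \<in> centers" for v
  proof -
    have "B x v = 0" "B (A x) v = 0" using xR R_g(2)[OF xR] v by (simp_all add: R_def)
    moreover have "A x \<noteq> c *s x" for c using no_ev1 x unfolding A_def by blast
    ultimately obtain a b where "v = a *s x + b *s A x"
      using in_isotropic_plane[OF x _ _ ] A_alt B_eq_0_commute by blast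
    then show ?thesis using xR R_g(2) R_add R_scale by simp
  qed
  obtain v where v: "v \<in> centers" using centers_ne by blast
  then have v0: "v \<noteq> 0" by (simp add: centers_def)
  have vA: "A v \<noteq> c *s v" for c using no_ev1 v0 unfolding A_def by blast
  have plane: "\<exists>a b. z = a *s v + b *s A v" if "B z v = 0" "B z (A v) = 0" for z
    using in_isotropic_plane[OF v0 vA] A_alt that B_eq_0_commute by blast
  have vR: "v \<in> R" "A v \<in> R" using SR[OF v] R_g(2) by blast+
  have R_perp: "z \<in> R" if z: "\<And>r. r \<in> R \<Longrightarrow> B z r = 0" for z
  proof -
    obtain a b where "z = a *s v + b *s A v" using plane z vR by blast
    then show ?thesis using vR R_add R_scale by simp
  qed
  \<comment> \<open>Since \<open>A\<close> is self-adjoint and preserves \<open>R\<close>, each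
    vector of \<open>R\<close> is orthogonal to \<open>A v\<close> as well as to \<open>v\<close>,
    and these two span \<open>R\<close>.\<close>
  have R_iso: "B r r' = 0" if "r \<in> R" "r' \<in> R" for r r'
  proof -
    have "B r v = 0" if "r \<in> R" for r using that v by (simp add: R_def)
    moreover have "B r (A v) = 0" if "r \<in> R" for r
      using A_sa[of r v] R_g(2)[OF that] v by (simp add: R_def)
    moreover from calculation obtain a b where "r' = a *s v + b *s A v"
      using plane[of r'] \<open>r' \<in> R\<close> by blast
    ultimately show ?thesis using \<open>r \<in> R\<close> by (simp add: B_simps)
  qed
  have A'_quad: "A' (A' x) = (s + s') *s A' x - (s * s') *s x" for x
    using quad2 by (simp add: A'_def Let_def)
  have A'_lin: "A' (x + y) = A' x + A' y" "A' (c *s x) = c *s A' x" for x y c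
    by (simp_all add: A'_def iso algebra_simps)
  have A'_diff: "A' (x - y) = A' x - A' y" for x y
    using A'_lin(1)[of x "- 1 *s y"] A'_lin(2)[of "-1" y] by simp
  have EF: "B p q = 0" if "A' p = s *s p" "A' q = s' *s q" for p q
    using A'_sa[of p q] that s by (simp add: B_simps)
  have AE: "A' e = s *s e" "A' f = s' *s f" using e f by (simp_all add: A'_def)
  have A'g: "A' (g2 x) = g2 (A' x)" for x by (simp add: A'_def iso g2)
  define E0 where "E0 \<longleftrightarrow> (\<forall>p\<in>R. A' p = s *s p \<longrightarrow> p = 0)"
  define F0 where "F0 \<longleftrightarrow> (\<forall>q\<in>R. A' q = s' *s q \<longrightarrow> q = 0)"
  consider F0 | E0 | "\<not> E0" "\<not> F0" by blast
  then show False
  proof cases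
    case 1
    \<comment> \<open>By the quadratic equation \<open>A' - s\<close> maps into the eigenspace of
      \<open>s'\<close>, which meets \<open>R\<close> only in zero. Then \<open>f\<close>, being
      orthogonal to the eigenspace of \<open>s\<close>, falls into \<open>R\<close>.\<close>
    have "A' r = s *s r" if "r \<in> R" for r
    proof -
      have "A' r + (- s) *s r \<in> R" by (intro R_add R_scale R_g that)
      moreover have "A' (A' r + (- s) *s r) = s' *s (A' r + (- s) *s r)"
        unfolding A'_lin A'_quad by (simp add: algebra_simps)
      ultimately have "A' r + (- s) *s r = 0" using 1 unfolding F0_def by blast
      then show ?thesis by simp
    qed
    then have "B f r = 0" if "r \<in> R" for r using EF[OF _ AE(2)] that B_eq_0_commute by blast
    then have "f \<in> R" using R_perp by blast
    then show False using 1 F0_def AE(2) f(1) by blast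
  next
    case 2
    have "A' r = s' *s r" if "r \<in> R" for r
    proof -
      have "A' r + (- s') *s r \<in> R" by (intro R_add R_scale R_g that)
      moreover have "A' (A' r + (- s') *s r) = s *s (A' r + (- s') *s r)"
        unfolding A'_lin A'_quad by (simp add: algebra_simps)
      ultimately have "A' r + (- s') *s r = 0" using 2 unfolding E0_def by blast
      then show ?thesis by simp
    qed
    then have "B e r = 0" if "r \<in> R" for r using EF[OF AE(1)] that by blast
    then have "e \<in> R" using R_perp by blast
    then show False using 2 E0_def AE(1) e(1) by blast
  next
    case 3
    then obtain p q where pq: "p \<in> R" "p \<noteq> 0" "A' p = s *s p" "q \<in> R" "q \<noteq> 0" "A' q = s' *s q"
      unfolding E0_def F0_def by blast
    \<comment> \<open>As \<open>p\<close> is no eigenvector of \<open>g2\<close>, the plane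
      \<open>R\<close> is spanned by \<open>p\<close> and \<open>g2 p\<close>. Both belong to the
      eigenvalue \<open>s\<close>, since \<open>g2\<close> commutes with \<open>A'\<close>, which
      leaves no room for \<open>q\<close>.\<close>
    have "g2 p \<in> R" using pq R_g by blast
    moreover have "g2 p \<noteq> m *s p" for m using no_ev2 pq unfolding A'_def by blast
    ultimately obtain a b where ab: "q = a *s p + b *s g2 p"
      using in_isotropic_plane[OF pq(2)] R_iso pq by blast
    have "A' q = s *s q" by (simp add: ab A'_lin A'g pq(3) iso algebra_simps)
    then show False using s pq(5,6) by simp
  qed
qed

text \<open>Suppose every center lies in the plane \<open>H\<close> of \<open>v\<close>,
  \<open>w\<close> or in its complement \<open>H'\<close>. The centers \<open>g v\<close> and
  \<open>g w\<close> are not orthogonal, so they fall on the same side. If it is \<open>H\<close>,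
  then \<open>A v\<close> lies in \<open>H\<close> and is a multiple of \<open>v\<close>. If it is
  \<open>H'\<close>, then \<open>A\<close> swaps the planes, so \<open>A (A v)\<close> should lie in
  \<open>H\<close>, against its component \<open>\<tau> *s A v\<close> in \<open>H'\<close>.\<close>

lemma centers_not_two_planes:
  assumes v: "v \<in> centers" and w: "w \<in> centers" and vw: "B v w \<noteq> 0"
    and g: "g \<in> G" "\<And>x. h (g x) = x" "\<And>x. g (h x) = x"
    and no_ev: "\<And>x m. g x + h x = m *s x \<Longrightarrow> x = 0"
    and quad: "\<And>x. (let A = \<lambda>x. g x + h x in A (A x) = \<tau> *s A x + \<nu> *s x)" and \<tau>: "\<tau> \<noteq> 0"
  shows "\<exists>u\<in>centers. (\<forall>a b. u \<noteq> a *s v + b *s w) \<and> (B v u \<noteq> 0 \<or> B w u \<noteq> 0)"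
proof (rule ccontr)
  define A where "A = (\<lambda>x. g x + h x)"
  note iso = isometryD[OF isometryG[OF g(1)]] isometryD[OF adjoint(3)[OF g]]
  note adj = adjoint(1,2)[OF g]
  have v0: "v \<noteq> 0" "w \<noteq> 0" using v w by (auto simp: centers_def)
  define H where "H = {a *s v + b *s w | a b. True}"
  define H' where "H' = {u. B v u = 0 \<and> B w u = 0}"
  assume "\<not> ?thesis"
  then have SH: "u \<in> H \<or> u \<in> H'" if "u \<in> centers" for u using that unfolding H_def H'_def by blast
  have HH': "B x y = 0" "B y x = 0" if "x \<in> H" "y \<in> H'" for x y
  proof -
    show "B x y = 0" using that by (auto simp: H_def H'_def B_simps)
    then show "B y x = 0" using B_eq_0_commute by blast
  qed
  have "1 *s v + 0 *s w \<in> H" "0 *s v + 1 *s w \<in> H" unfolding H_def by blast+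
  then have vwH: "v \<in> H" "w \<in> H" by simp_all
  have no_both: "x = 0" if x: "x \<in> H" "x \<in> H'" for x
  proof -
    obtain a b where ab: "x = a *s v + b *s w" using x H_def by blast
    have "B x v = 0" "B x w = 0" using HH'(2) x(2) vwH by blast+
    then show ?thesis using hyperbolic_plane_pairing[OF vw, of a b] by (auto simp: ab)
  qed
  have H_add: "x + y \<in> H" if xy: "x \<in> H" "y \<in> H" for x y
  proof -
    obtain e f e' f' where "x = e *s v + f *s w" "y = e' *s v + f' *s w" using xy H_def by blast
    then have "x + y = (e + e') *s v + (f + f') *s w" by (simp add: algebra_simps)
    then show ?thesis unfolding H_def by blast
  qed
  have H'_add: "x + y \<in> H'" if "x \<in> H'" "y \<in> H'" for x y using that by (simp add: H'_def B_simps)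
  have "\<exists>k\<in>G. \<forall>x. k x = h x" using inv_in_G[OF g(1)] g(2,3) by metis
  then have hG: "h \<in> G" by (metis ext)
  have inS: "g v \<in> centers" "g w \<in> centers" "h v \<in> centers" "h w \<in> centers" using centers_image v w g(1) hG by blast+
  then have ne: "g v \<noteq> 0" "g w \<noteq> 0" "h v \<noteq> 0" "h w \<noteq> 0" by (auto simp: centers_def)
  have gvw: "B (g v) (g w) \<noteq> 0" "B (h v) (h w) \<noteq> 0" using vw iso by simp_all
  have Av: "A v \<noteq> 0" using no_ev[of v 0] v0 by (auto simp: A_def)
  consider "g v \<in> H" "g w \<in> H" | "g v \<in> H'" "g w \<in> H'"
    using SH[OF inS(1)] SH[OF inS(2)] gvw HH' by blast
  then show False
  proof cases
    case 1
    \<comment> \<open>Otherwise \<open>h v\<close> and \<open>h w\<close> both lie in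
      \<open>H'\<close>, and by adjointness \<open>g w\<close>, which is in \<open>H\<close>, is
      orthogonal to \<open>H\<close>.\<close>
    have "h v \<in> H"
    proof (rule ccontr)
      assume "h v \<notin> H"
      then have "h v \<in> H'" "h w \<in> H'" using SH[OF inS(3)] SH[OF inS(4)] gvw HH' by blast+
      then have "B (h v) w = 0" "B (h w) w = 0" using HH' vwH by blast+
      then have "g w \<in> H'" by (simp add: adj H'_def)
      then show False using no_both 1 ne by blast
    qed
    then have "A v \<in> H" using 1 H_add by (simp add: A_def)
    then obtain a b where ab: "A v = a *s v + b *s w" using H_def by blast
    have "B (A v) v = 0" unfolding A_def by (rule sum_inverse_alternating[OF g])
    then have "b * B w v = 0" by (simp add: ab B_simps)
    then have "A v = a *s v" using ab vw B_eq_0_commute by auto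
    then show False using no_ev v0 unfolding A_def by blast
  next
    case 2
    \<comment> \<open>Here \<open>v\<close>, \<open>w\<close> and \<open>g v\<close>,
      \<open>g w\<close> are orthogonal hyperbolic pairs, so they span the whole space.\<close>
    have zero: "x = 0" if "B x v = 0" "B x w = 0" "B x (g v) = 0" "B x (g w) = 0" for x
      using orthogonal_to_hyperbolic_pairs[OF vw gvw(1)] 2 that by (simp add: H'_def)
    have "h v \<in> H'"
    proof (rule ccontr)
      assume "h v \<notin> H'"
      then have "h v \<in> H" using SH[OF inS(3)] by blast
      moreover have "B (h v) v = 0" "B (h v) w = 0" using HH' vwH 2 by (simp_all add: adj)
      then have "h v \<in> H'" using B_eq_0_commute by (simp add: H'_def)
      ultimately show False using no_both ne by blast
    qed
    then have AvH': "A v \<in> H'" using 2 H'_add by (simp add: A_def)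
    have "B (A v) v = 0" "B (A v) w = 0" using HH' vwH AvH' by blast+
    then obtain q where q: "q \<in> {v, w}" "B (A v) (g q) \<noteq> 0" using zero[of "A v"] Av by blast
    then have qH: "g q \<in> H'" "q \<in> centers" "q \<in> H" using 2 v w vwH by auto
    have "g (g q) \<in> H"
    proof (rule ccontr)
      assume "g (g q) \<notin> H"
      moreover have ggS: "g (g q) \<in> centers" using centers_image g(1) qH by blast
      ultimately have "g (g q) \<in> H'" using SH by blast
      moreover have "B (g (g q)) (g v) = 0" "B (g (g q)) (g w) = 0" using HH' vwH qH iso by simp_all
      ultimately have "g (g q) = 0" using zero[of "g (g q)"] HH' vwH by blast
      then show False using ggS by (simp add: centers_def)
    qed
    \<comment> \<open>Both \<open>g (g q)\<close> and \<open>q\<close> lie in \<open>H\<close>,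
      hence so does \<open>A (g q)\<close>. Pairing the quadratic equation with \<open>g q\<close>
      leaves only \<open>\<tau> * B (A v) (g q) = 0\<close>.\<close>
    then have "B (A v) (A (g q)) = 0"
      using HH'(2)[OF _ AvH'] qH g(2) by (simp add: A_def B_simps)
    moreover have "A (A v) = \<tau> *s A v + \<nu> *s v" using quad by (simp add: A_def Let_def)
    then have "B (A (A v)) (g q) = \<tau> * B (A v) (g q)" using HH'(1)[OF vwH(1) qH(1)] by (simp add: B_simps)
    moreover have "B (A (A v)) (g q) = B (A v) (A (g q))"
      unfolding A_def by (rule sum_inverse_selfadjoint[OF g])
    ultimately show False using \<tau> q by simp
  qed
qed

section \<open>Generation of the isometry group by transvections\<close>

definition supported_on :: "'b set \<Rightarrow> ('b \<Rightarrow> 'b) set" where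
  "supported_on U = {h \<in> G. (\<forall>u\<in>U. h u \<in> U) \<and> (\<forall>x. (\<forall>u\<in>U. B x u = 0) \<longrightarrow> h x = x)}"

lemma supported_on_comp:
  "k \<in> supported_on U \<Longrightarrow> h \<in> supported_on U \<Longrightarrow> k \<circ> h \<in> supported_on U"
  by (simp add: supported_on_def comp_in_G)

context
  assumes centers_all: "\<And>v. v \<noteq> 0 \<Longrightarrow> v \<in> centers"
begin

text \<open>The transvection along \<open>v - w\<close> with coefficient \<open>1 / B v w\<close>
  does it, because \<open>B v (v - w) = - B v w\<close>.\<close>

lemma move_step:
  assumes U: "subspace U" and "v \<in> U" "w \<in> U" and "B v w \<noteq> 0"
  shows "\<exists>h\<in>supported_on U. h v = w \<and> (\<forall>x. B x (v - w) = 0 \<longrightarrow> h x = x)"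
proof
  let ?h = "transvec (v - w) (1 / B v w)"
  have vwU: "v - w \<in> U" using subspace_diff[OF U] assms by blast
  have "v - w \<noteq> 0" using assms by auto
  then have "?h \<in> G" using centers_all by (simp add: centers_def)
  moreover have "?h u \<in> U" if "u \<in> U" for u
    unfolding transvec_def by (intro subspace_add[OF U] subspace_scale[OF U] vwU that)
  ultimately show "?h \<in> supported_on U" using vwU by (simp add: supported_on_def transvec_def)
  show "?h v = w \<and> (\<forall>x. B x (v - w) = 0 \<longrightarrow> ?h x = x)"
    using assms by (simp add: transvec_def B_diff_right)
qed

text \<open>Two steps suffice, through a vector of \<open>U\<close> that pairs with both
  \<open>v\<close> and \<open>w\<close>.\<close>

lemma move_vector:
  assumes U: "subspace U" "\<And>x. x \<in> U \<Longrightarrow> x \<noteq> 0 \<Longrightarrow> \<exists>y\<in>U. B x y \<noteq> 0"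
    and v: "v \<in> U" "v \<noteq> 0" and w: "w \<in> U" "w \<noteq> 0"
  shows "\<exists>h\<in>supported_on U. h v = w"
proof -
  obtain p q where "p \<in> U" "B v p \<noteq> 0" "q \<in> U" "B w q \<noteq> 0" using U(2) v w by blast
  then obtain z where z: "z \<in> U" "B v z \<noteq> 0" "B w z \<noteq> 0"
    using common_pairing[of v p w q U] subspace_add[OF U(1)] by blast
  obtain h where h: "h \<in> supported_on U" "h v = z" using move_step[OF U(1) v(1) z(1,2)] by blast
  have "B z w \<noteq> 0" using z(3) B_eq_0_commute by blast
  then obtain k where k: "k \<in> supported_on U" "k z = w" using move_step[OF U(1) z(1) w(1)] by blast
  have "(k \<circ> h) v = w" using h k by simp
  then show ?thesis using supported_on_comp[OF k(1) h(1)] by blast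
qed

text \<open>A step from \<open>w\<close> to \<open>w'\<close> fixes \<open>v\<close>, since
  \<open>v\<close> is orthogonal to \<open>w - w'\<close>. If \<open>w\<close> and \<open>w'\<close>
  are orthogonal, the detour through \<open>w + v\<close> has nonzero pairings at both steps and
  still fixes \<open>v\<close>.\<close>

lemma move_partner:
  assumes U: "subspace U" and v: "v \<in> U" and w: "w \<in> U" "w' \<in> U"
    and B: "B v w = B v w'" "B v w \<noteq> 0"
  shows "\<exists>h\<in>supported_on U. h v = v \<and> h w = w'"
proof (cases "B w w' = 0")
  case False
  moreover have "B v (w - w') = 0" using B by (simp add: B_diff_right)
  ultimately show ?thesis using move_step[OF U w] by blast
next
  case True
  have wv: "w + v \<in> U" using subspace_add[OF U] v w by blast
  have "B w (w + v) \<noteq> 0" using B B_eq_0_commute by (simp add: B_add_right)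
  moreover have "B v (w - (w + v)) = 0" using B by (simp add: B_simps)
  ultimately obtain h where h: "h \<in> supported_on U" "h w = w + v" "h v = v"
    using move_step[OF U w(1) wv] by blast
  have "B (w + v) w' \<noteq> 0" using B True by (simp add: B_add_left)
  moreover have "B v (w + v - w') = 0" using B by (simp add: B_simps)
  ultimately obtain k where k: "k \<in> supported_on U" "k (w + v) = w'" "k v = v"
    using move_step[OF U wv w(2)] by blast
  have "(k \<circ> h) v = v \<and> (k \<circ> h) w = w'" using h k by simp
  then show ?thesis using supported_on_comp[OF k(1) h(1)] by blast
qed

lemma move_hyperbolic_pair:
  assumes U: "subspace U" "\<And>x. x \<in> U \<Longrightarrow> x \<noteq> 0 \<Longrightarrow> \<exists>y\<in>U. B x y \<noteq> 0"
    and v: "v \<in> U" "v' \<in> U" and w: "w \<in> U" "w' \<in> U"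
    and B: "B v w = B v' w'" "B v w \<noteq> 0"
  shows "\<exists>h\<in>supported_on U. h v = v' \<and> h w = w'"
proof -
  have "v \<noteq> 0" "v' \<noteq> 0" using B by auto
  then obtain h where h: "h \<in> supported_on U" "h v = v'"
    using move_vector[OF U v(1) _ v(2)] by blast
  then have "isometry h" "h w \<in> U" using isometryG w by (simp_all add: supported_on_def)
  moreover from this have "B v' (h w) = B v' w'" using isometryD(3)[of h v w] B h(2) by simp
  ultimately obtain k where k: "k \<in> supported_on U" "k v' = v'" "k (h w) = w'"
    using move_partner[OF U(1) v(2) _ w(2)] B by metis
  have "(k \<circ> h) v = v' \<and> (k \<circ> h) w = w'" using h k by simp
  then show ?thesis using supported_on_comp[OF k(1) h(1)] by blast
qed

text \<open>An argument in the style of Witt's theorem. Dividing \<open>f\<close> by an element of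
  \<open>G\<close> that agrees with it on \<open>v\<close>, \<open>w\<close> leaves an isometry
  \<open>f'\<close> that fixes this pair and preserves its complement \<open>U\<close>. There it is
  matched on \<open>r\<close>, \<open>s\<close> by some \<open>k\<close> in
  \<open>supported_on U\<close>; such a \<open>k\<close> fixes \<open>v\<close> and
  \<open>w\<close>, so it agrees with \<open>f'\<close> on a basis.\<close>

lemma isometry_in_G:
  assumes vw: "B v w \<noteq> 0" and rs: "B r s \<noteq> 0"
    and orth: "B v r = 0" "B w r = 0" "B v s = 0" "B w s = 0"
    and f: "isometry f"
  shows "f \<in> G"
proof -
  note isof = isometryD[OF f]
  have "B v w = B (f v) (f w)" using isof by simp
  then obtain h where h: "h \<in> G" "h v = f v" "h w = f w"
    using move_hyperbolic_pair[of UNIV v "f v" w "f w"] nondegenerate vw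
    by (auto simp: supported_on_def)
  obtain h' where h': "h' \<in> G" "\<And>x. h' (h x) = x" "\<And>x. h (h' x) = x" using inv_in_G[OF h(1)] by blast
  note isoh' = isometryD[OF isometryG[OF h'(1)]]
  define f' where "f' = h' \<circ> f"
  have f': "isometry f'" using isof isoh' by (simp add: isometry_def f'_def)
  note isof' = isometryD[OF f']
  have fix_vw: "f' v = v" "f' w = w" using h h' by (metis f'_def comp_apply)+
  define U where "U = {u. B v u = 0 \<and> B w u = 0}"
  have U: "subspace U" by (rule subspaceI) (simp_all add: U_def B_simps)
  have rsU: "r \<in> U" "s \<in> U" using orth by (simp_all add: U_def)
  have U_nondeg: "\<exists>y\<in>U. B x y \<noteq> 0" if "x \<in> U" "x \<noteq> 0" for x
    using orthogonal_to_hyperbolic_pairs[OF vw rs orth, of x] that rsU B_eq_0_commute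
    unfolding U_def by blast
  have "f' r \<in> U" "f' s \<in> U"
    using orth isof'(3)[of v r] isof'(3)[of w r] isof'(3)[of v s] isof'(3)[of w s]
    by (simp_all add: U_def fix_vw)
  moreover have "B r s = B (f' r) (f' s)" using isof' by simp
  ultimately obtain k where k: "k \<in> supported_on U" "k r = f' r" "k s = f' s"
    using move_hyperbolic_pair[OF U U_nondeg rsU(1) _ rsU(2)] rs by blast
  have kG: "k \<in> G" using k by (simp add: supported_on_def)
  have "k v = v" "k w = w" using k(1) by (simp_all add: supported_on_def U_def)
  note agree = this fix_vw k(2,3)
  note isok = isometryD[OF isometryG[OF kG]]
  have "k = f'"
  proof
    fix z
    show "k z = f' z"
      by (subst (1 2) hyperbolic_decomposition[OF vw rs orth, of z]) (simp only: isok isof' agree)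
  qed
  then have "f = h \<circ> k" using h' by (auto simp: f'_def)
  then show ?thesis using comp_in_G[OF h(1) kG] by simp
qed

end

text \<open>No characteristic polynomial occurs here: \<open>\<tau>\<close> takes the place of the
  sum of the four roots for \<open>g1\<close>, and \<open>s\<close>, \<open>s'\<close> that of the
  two sums of a root and its reciprocal for \<open>g2\<close>.\<close>

theorem all_isometries:
  assumes centers_ne: "centers \<noteq> {}"
    and g1: "g1 \<in> G" "\<And>x. h1 (g1 x) = x" "\<And>x. g1 (h1 x) = x"
    and no_ev1: "\<And>x m. g1 x + h1 x = m *s x \<Longrightarrow> x = 0"
    and quad1: "\<And>x. (let A = \<lambda>x. g1 x + h1 x in A (A x) = \<tau> *s A x + \<nu> *s x)" and \<tau>: "\<tau> \<noteq> 0"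
    and g2: "g2 \<in> G" "\<And>x. h2 (g2 x) = x" "\<And>x. g2 (h2 x) = x"
    and quad2: "\<And>x. (let A = \<lambda>x. g2 x + h2 x in A (A x) = (s + s') *s A x - (s * s') *s x)"
    and s: "s \<noteq> s'"
    and e: "e \<noteq> 0" "g2 e + h2 e = s *s e" and f: "f \<noteq> 0" "g2 f + h2 f = s' *s f"
    and no_ev2: "\<And>x m. g2 x + h2 x = s *s x \<Longrightarrow> g2 x = m *s x \<Longrightarrow> x = 0"
    and basis: "B v w \<noteq> 0" "B p q \<noteq> 0" "B v p = 0" "B w p = 0" "B v q = 0" "B w q = 0"
    and iso: "isometry f'"
  shows "f' \<in> G"
proof -
  have radical: "\<exists>s\<in>centers. B x s \<noteq> 0" if "x \<noteq> 0" for x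
    by (rule centers_complement_trivial[OF centers_ne g1 no_ev1 g2 quad2 s e f no_ev2 that])
  obtain a where a: "a \<in> centers" using centers_ne by blast
  then have "a \<noteq> 0" by (simp add: centers_def)
  then obtain b where b: "b \<in> centers" "B a b \<noteq> 0" using radical by blast
  have "\<exists>u\<in>centers. (\<forall>c d. u \<noteq> c *s a + d *s b) \<and> (B a u \<noteq> 0 \<or> B b u \<noteq> 0)"
    by (rule centers_not_two_planes[OF a b g1 _ quad1 \<tau>]) (rule no_ev1)
  then obtain u where u: "u \<in> centers" "\<And>c d. u \<noteq> c *s a + d *s b" "B a u \<noteq> 0 \<or> B b u \<noteq> 0" by blast
  have "z \<in> centers" if "z \<noteq> 0" for z by (rule centers_everything[OF a b radical u that])
  then show ?thesis using isometry_in_G[OF _ basis iso] by blast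
qed

end

section \<open>The standard symplectic space and its matrix group\<close>

text \<open>The locale wants its vectors to fill a whole type of class \<open>ab_group_add\<close>;
  tuples with componentwise addition do.\<close>

type_synonym 'a quad = "'a \<times> 'a \<times> 'a \<times> 'a"

fun qscale :: "'a::times \<Rightarrow> 'a quad \<Rightarrow> 'a quad" where
  "qscale c (x0, x1, x2, x3) = (c * x0, c * x1, c * x2, c * x3)"

text \<open>The bilinear form with Gram matrix \<open>symplectic_form_mat\<close>; coordinates 0, 2
  and 1, 3 give the hyperbolic pairs.\<close>

fun qform :: "'a::comm_ring_1 quad \<Rightarrow> 'a quad \<Rightarrow> 'a" where
  "qform (x0, x1, x2, x3) (y0, y1, y2, y3) = x0 * y2 + x1 * y3 - x2 * y0 - x3 * y1"

fun qapply :: "'a::comm_ring_1 mat \<Rightarrow> 'a quad \<Rightarrow> 'a quad" where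
  "qapply A (x0, x1, x2, x3) =
    (A $$ (0,0) * x0 + A $$ (0,1) * x1 + A $$ (0,2) * x2 + A $$ (0,3) * x3,
     A $$ (1,0) * x0 + A $$ (1,1) * x1 + A $$ (1,2) * x2 + A $$ (1,3) * x3,
     A $$ (2,0) * x0 + A $$ (2,1) * x1 + A $$ (2,2) * x2 + A $$ (2,3) * x3,
     A $$ (3,0) * x0 + A $$ (3,1) * x1 + A $$ (3,2) * x2 + A $$ (3,3) * x3)"

lemma symplectic_space4_quad:
  assumes "(2::'a::field) \<noteq> 0"
  shows "symplectic_space4 (qscale :: 'a \<Rightarrow> _) qform"
proof
  fix x :: "'a quad"
  assume "x \<noteq> 0"
  moreover obtain x0 x1 x2 x3 where x: "x = (x0, x1, x2, x3)" by (cases x)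
  ultimately have "qform x (0, 0, 1, 0) \<noteq> 0 \<or> qform x (0, 0, 0, 1) \<noteq> 0 \<or>
      qform x (1, 0, 0, 0) \<noteq> 0 \<or> qform x (0, 1, 0, 0) \<noteq> 0" by (auto simp: zero_prod_def)
  then show "\<exists>y. qform x y \<noteq> 0" by blast
next
  fix x y z w u :: "'a quad"
  obtain x0 x1 x2 x3 y0 y1 y2 y3 z0 z1 z2 z3 w0 w1 w2 w3 u0 u1 u2 u3 where
    "x = (x0, x1, x2, x3)" "y = (y0, y1, y2, y3)" "z = (z0, z1, z2, z3)"
    "w = (w0, w1, w2, w3)" "u = (u0, u1, u2, u3)" by (metis prod_cases4)
  then show "qscale (pfaffian qform x y z w) u =
      qscale (pfaffian qform u y z w) x + qscale (pfaffian qform x u z w) y +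
      qscale (pfaffian qform x y u w) z + qscale (pfaffian qform x y z u) w"
    by (simp add: pfaffian_def algebra_simps)
qed (use assms in \<open>auto simp: algebra_simps\<close>)

section \<open>Symplectic matrices and their action on quadruples\<close>

lemma Sp4_simps:
  "carrier Sp4 = {A \<in> carrier_mat 4 4. A\<^sup>T * symplectic_form_mat * A = symplectic_form_mat}"
  "x \<otimes>\<^bsub>Sp4\<^esub> y = x * y" "\<one>\<^bsub>Sp4\<^esub> = 1\<^sub>m 4"
  by (simp_all add: Sp4_def)

lemma symplectic_form_mat_carrier: "symplectic_form_mat \<in> carrier_mat 4 4"
  unfolding symplectic_form_mat_def
  using four_block_carrier_mat[of "0\<^sub>m 2 2" 2 2 "0\<^sub>m 2 2" 2 2] by simp

lemma less_4_cases: "i < 4 \<longleftrightarrow> i = 0 \<or> i = 1 \<or> i = 2 \<or> i = (3::nat)" by auto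

lemma sum_4: "(\<Sum>i = 0..<4. f i) = f 0 + f 1 + f 2 + f (3::nat)"
  by (simp add: eval_nat_numeral add.assoc)

lemma mat_mult_4:
  assumes "A \<in> carrier_mat 4 4" "B \<in> carrier_mat 4 4" "i < 4" "j < 4"
  shows "(A * B) $$ (i,j) = A $$ (i,0) * B $$ (0,j) + A $$ (i,1) * B $$ (1,j) +
    A $$ (i,2) * B $$ (2,j) + A $$ (i,3) * B $$ (3,j)"
  using assms by (simp add: scalar_prod_def sum_4)

lemma symplectic_form_mat_entry:
  assumes "i < 4" "j < 4"
  shows "symplectic_form_mat $$ (i,j) = (if j = i + 2 then 1 else if i = j + 2 then - 1 else 0)"
  using assms unfolding symplectic_form_mat_def
  by (subst index_mat_four_block) (auto simp: index_mat_four_block)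

lemma symplectic_form_mat_square: "symplectic_form_mat * symplectic_form_mat = - 1\<^sub>m 4"
proof (rule eq_matI)
  note J = symplectic_form_mat_carrier
  fix i j assume "i < dim_row (- 1\<^sub>m 4 :: 'a mat)" "j < dim_col (- 1\<^sub>m 4 :: 'a mat)"
  then have ij: "i < 4" "j < 4" by simp_all
  have "(symplectic_form_mat * symplectic_form_mat) $$ (i,j) =
      (\<Sum>k=0..<4. symplectic_form_mat $$ (i,k) * symplectic_form_mat $$ (k,j) :: 'a)"
    unfolding mat_mult_4[OF J J ij] sum_4 ..
  also have "\<dots> = (- 1\<^sub>m 4) $$ (i,j)"
    using ij unfolding sum_4 less_4_cases by (elim disjE) (simp_all add: symplectic_form_mat_entry)
  finally show "(symplectic_form_mat * symplectic_form_mat) $$ (i,j) = (- 1\<^sub>m 4 :: 'a mat) $$ (i,j)" .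
qed (use symplectic_form_mat_carrier in auto)

lemma qapply_mult:
  assumes "A \<in> carrier_mat 4 4" "B \<in> carrier_mat 4 4"
  shows "qapply (A * B) x = qapply A (qapply B x)"
  by (cases x) (simp add: mat_mult_4[OF assms] algebra_simps)

lemma qapply_one: "qapply (1\<^sub>m 4) x = x"
  by (cases x) simp

lemma qapply_add: "qapply A (x + y) = qapply A x + qapply A y"
  by (cases x; cases y) (simp add: algebra_simps)

lemma qapply_scale: "qapply A (qscale c x) = qscale c (qapply A x)"
  by (cases x) (simp add: algebra_simps)

lemma qapply_inject:
  assumes A: "A \<in> carrier_mat 4 4" and B: "B \<in> carrier_mat 4 4" and eq: "\<And>x. qapply A x = qapply B x"
  shows "A = B"
proof (rule eq_matI)
  fix i j assume "i < dim_row B" "j < dim_col B"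
  then show "A $$ (i,j) = B $$ (i,j)"
    using B eq[of "(1,0,0,0)"] eq[of "(0,1,0,0)"] eq[of "(0,0,1,0)"] eq[of "(0,0,0,1)"]
    by (auto simp: less_4_cases)
qed (use A B in auto)

lemma Sp4_entries:
  assumes "A \<in> carrier Sp4" "i < 4" "j < 4"
  shows "A $$ (0,i) * A $$ (2,j) + A $$ (1,i) * A $$ (3,j) - A $$ (2,i) * A $$ (0,j) - A $$ (3,i) * A $$ (1,j)
     = symplectic_form_mat $$ (i,j)"
proof -
  have A: "A \<in> carrier_mat 4 4" and eq: "A\<^sup>T * symplectic_form_mat * A = symplectic_form_mat"
    using assms by (simp_all add: Sp4_simps)
  note J = symplectic_form_mat_carrier
  have AJ: "A\<^sup>T * symplectic_form_mat \<in> carrier_mat 4 4"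
    using A J by (intro mult_carrier_mat[of _ 4 4]) auto
  have "(A\<^sup>T * symplectic_form_mat) $$ (i,k) = (\<Sum>l=0..<4. A $$ (l,i) * symplectic_form_mat $$ (l,k))"
    if "k < 4" for k
    using that A assms(2) mat_mult_4[of "A\<^sup>T", OF _ J assms(2)] unfolding sum_4 by simp
  then have "(A\<^sup>T * symplectic_form_mat * A) $$ (i,j) =
     A $$ (0,i) * A $$ (2,j) + A $$ (1,i) * A $$ (3,j) - A $$ (2,i) * A $$ (0,j) - A $$ (3,i) * A $$ (1,j)"
    unfolding mat_mult_4[OF AJ A assms(2,3)] by (simp add: sum_4 symplectic_form_mat_entry)
  then show ?thesis by (simp add: eq)
qed

lemma qform_qapply:
  assumes A: "A \<in> carrier Sp4"
  shows "qform (qapply A x) (qapply A y) = qform x y"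
proof -
  obtain x0 x1 x2 x3 y0 y1 y2 y3 where xy: "x = (x0, x1, x2, x3)" "y = (y0, y1, y2, y3)"
    by (metis prod_cases4)
  define E where "E = (\<lambda>i j. A $$ (0,i) * A $$ (2,j) + A $$ (1,i) * A $$ (3,j) - A $$ (2,i) * A $$ (0,j) - A $$ (3,i) * A $$ (1,j))"
  have E: "E i j = (if j = i + 2 then 1 else if i = j + 2 then - 1 else 0)" if "i < 4" "j < 4" for i j
    using Sp4_entries[OF A that] symplectic_form_mat_entry[OF that] by (simp add: E_def)
  have "qform (qapply A x) (qapply A y) =
     x0 * (y0 * E 0 0 + y1 * E 0 1 + y2 * E 0 2 + y3 * E 0 3) +
     x1 * (y0 * E 1 0 + y1 * E 1 1 + y2 * E 1 2 + y3 * E 1 3) +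
     x2 * (y0 * E 2 0 + y1 * E 2 1 + y2 * E 2 2 + y3 * E 2 3) +
     x3 * (y0 * E 3 0 + y1 * E 3 1 + y2 * E 3 2 + y3 * E 3 3)"
    unfolding xy E_def by (simp add: algebra_simps)
  also have "\<dots> = qform x y" by (simp add: E xy)
  finally show ?thesis .
qed

lemma Sp4_mult_closed:
  assumes "A \<in> carrier Sp4" "B \<in> carrier Sp4"
  shows "A * B \<in> carrier Sp4"
proof -
  let ?J = "symplectic_form_mat :: 'a mat"
  have A: "A \<in> carrier_mat 4 4" "A\<^sup>T \<in> carrier_mat 4 4" "A\<^sup>T * ?J * A = ?J"
    and B: "B \<in> carrier_mat 4 4" "B\<^sup>T \<in> carrier_mat 4 4" "B\<^sup>T * ?J * B = ?J"
    using assms by (simp_all add: Sp4_simps)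
  note J = symplectic_form_mat_carrier[where 'a = 'a]
  note assoc = assoc_mult_mat[of _ 4 4 _ 4 _ 4]
  have "(A * B)\<^sup>T * ?J * (A * B) = B\<^sup>T * (A\<^sup>T * ?J * A) * B"
    using A(1,2) B(1,2) J by (simp add: transpose_mult[OF A(1) B(1)] assoc mult_carrier_mat[of _ 4 4])
  then show ?thesis using A B by (simp add: Sp4_simps mult_carrier_mat[of _ 4 4])
qed

lemma Sp4_left_inverse:
  assumes "A \<in> carrier (Sp4 :: 'a::field mat monoid)"
  shows "\<exists>B\<in>carrier Sp4. B * A = 1\<^sub>m 4"
proof -
  let ?J = "symplectic_form_mat :: 'a mat"
  have A: "A \<in> carrier_mat 4 4" "A\<^sup>T \<in> carrier_mat 4 4" "A\<^sup>T * ?J * A = ?J"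
    using assms by (simp_all add: Sp4_simps)
  note J = symplectic_form_mat_carrier[where 'a = 'a]
  note assoc = assoc_mult_mat[of _ 4 4 _ 4 _ 4]
  \<comment> \<open>Since \<open>?J\<close> squares to \<open>- 1\<close>, multiplying the defining
    equation by \<open>- ?J\<close> on the left shows that this is a left inverse.\<close>
  define B where "B = - ?J * (A\<^sup>T * ?J)"
  have B: "B \<in> carrier_mat 4 4" "B\<^sup>T \<in> carrier_mat 4 4" unfolding B_def using A J by (auto intro!: mult_carrier_mat[of _ 4 4])
  have "B * A = - ?J * (A\<^sup>T * ?J * A)"
    unfolding B_def using A(1,2) J by (simp add: assoc mult_carrier_mat[of _ 4 4])
  also have "\<dots> = - (?J * ?J)" using A J by simp
  also have "\<dots> = 1\<^sub>m 4" by (simp add: symplectic_form_mat_square)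
  finally have BA: "B * A = 1\<^sub>m 4" .
  have AB: "A * B = 1\<^sub>m 4" by (rule mat_mult_left_right_inverse[OF B(1) A(1) BA])
  have "B\<^sup>T * ?J * B = B\<^sup>T * (A\<^sup>T * ?J * A) * B" by (simp add: A)
  also have "\<dots> = (B\<^sup>T * A\<^sup>T) * ?J * (A * B)"
    using A(1,2) B J by (simp add: assoc mult_carrier_mat[of _ 4 4])
  also have "\<dots> = ?J" unfolding transpose_mult[OF A(1) B(1), symmetric] AB using J by simp
  finally show ?thesis using B BA by (auto simp: Sp4_simps)
qed

lemma group_Sp4: "group (Sp4 :: 'a::field mat monoid)"
proof (rule groupI)
  fix A B C :: "'a mat"
  assume "A \<in> carrier Sp4" "B \<in> carrier Sp4" "C \<in> carrier Sp4"
  then show "A \<otimes>\<^bsub>Sp4\<^esub> B \<otimes>\<^bsub>Sp4\<^esub> C = A \<otimes>\<^bsub>Sp4\<^esub> (B \<otimes>\<^bsub>Sp4\<^esub> C)"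
    by (simp add: Sp4_simps assoc_mult_mat[of _ 4 4 _ 4 _ 4])
next
  show "\<one>\<^bsub>Sp4\<^esub> \<in> carrier (Sp4 :: 'a mat monoid)"
    using symplectic_form_mat_carrier[where 'a = 'a] by (simp add: Sp4_simps)
next
  fix A :: "'a mat"
  assume "A \<in> carrier Sp4"
  then show "\<one>\<^bsub>Sp4\<^esub> \<otimes>\<^bsub>Sp4\<^esub> A = A" by (simp add: Sp4_simps left_mult_one_mat[of _ 4 4])
qed (use Sp4_mult_closed Sp4_left_inverse in \<open>auto simp: Sp4_simps(2,3)\<close>)

lemma isometry_group_Sp4_subgroup:
  assumes two: "(2::'a::field) \<noteq> 0" and G: "subgroup G (Sp4 :: 'a mat monoid)"
  shows "isometry_group qscale qform (qapply ` G)"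
proof -
  interpret symplectic_space4 "qscale :: 'a \<Rightarrow> _" qform by (rule symplectic_space4_quad[OF two])
  interpret Sp: group "Sp4 :: 'a mat monoid" by (rule group_Sp4)
  have G_carrier: "A \<in> carrier_mat 4 4" if "A \<in> G" for A
    using subgroup.mem_carrier[OF G that] by (simp add: Sp4_simps)
  show ?thesis
  proof
    fix g assume "g \<in> qapply ` G"
    then obtain A where A: "A \<in> G" "g = qapply A" by blast
    note AC = subgroup.mem_carrier[OF G A(1)]
    show "isometry g" by (simp add: isometry_def A qapply_add qapply_scale qform_qapply[OF AC])
    define A' where "A' = inv\<^bsub>Sp4\<^esub> A"
    have A': "A' \<in> G" "A' * A = 1\<^sub>m 4" "A * A' = 1\<^sub>m 4"
      using subgroup.m_inv_closed[OF G A(1)] Sp.l_inv[OF AC] Sp.r_inv[OF AC]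
      by (simp_all add: A'_def Sp4_simps)
    have "qapply A' (g x) = x \<and> g (qapply A' x) = x" for x
      using qapply_mult[of A A' x] qapply_mult[of A' A x] G_carrier A A' by (simp add: qapply_one)
    then show "\<exists>h\<in>qapply ` G. \<forall>x. h (g x) = x \<and> g (h x) = x" using A'(1) by blast
  next
    have "(id :: 'a quad \<Rightarrow> _) = qapply (1\<^sub>m 4)" by (auto simp: qapply_one)
    then show "id \<in> qapply ` G" using subgroup.one_closed[OF G] by (auto simp: Sp4_simps)
  next
    fix g h assume "g \<in> qapply ` G" "h \<in> qapply ` G"
    then obtain A B where AB: "A \<in> G" "B \<in> G" "g = qapply A" "h = qapply B" by blast
    then have "g \<circ> h = qapply (A * B)" by (simp add: fun_eq_iff qapply_mult[OF G_carrier G_carrier])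
    then show "g \<circ> h \<in> qapply ` G" using subgroup.m_closed[OF G AB(1,2)] by (auto simp: Sp4_simps)
  qed
qed

section \<open>Matrices of rank one and transvections\<close>

lemma det2_eq_0:
  fixes a b p q r s :: "'a::field"
  assumes "p * a + q * b = 0" "r * a + s * b = 0" "a \<noteq> 0 \<or> b \<noteq> 0"
  shows "p * s = q * r"
proof -
  have "a * (p * s - q * r) = (p * a + q * b) * s - (r * a + s * b) * q"
    "b * (p * s - q * r) = (r * a + s * b) * p - (p * a + q * b) * r"
    by (simp_all add: algebra_simps)
  then show ?thesis using assms by auto
qed

text \<open>Two distinct columns are linearly dependent, as the rank would otherwise be at least 2,
  and a nontrivial relation between them makes every minor formed from them vanish.\<close>

lemma rank_one_minors:
  fixes M :: "'a::field mat"
  assumes M: "M \<in> carrier_mat n nc" and rank: "vec_space.rank n M = 1"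
    and ij: "i < n" "k < n" "j < nc" "l < nc"
  shows "M $$ (i,j) * M $$ (k,l) = M $$ (i,l) * M $$ (k,j)"
proof -
  interpret vec_space "TYPE('a)" n .
  have entry: "M $$ (r,c) = col M c $ r" if "r < n" "c < nc" for r c using M that by simp
  show ?thesis
  proof (cases "col M j = col M l")
    case True
    then show ?thesis using ij by (simp add: entry)
  next
    case False
    let ?N = "mat_of_cols n [col M j, col M l]"
    have cols: "cols ?N = [col M j, col M l]" using M by (intro cols_mat_of_cols) auto
    have N: "?N \<in> carrier_mat n 2" using mat_of_cols_carrier(1)[of n "[col M j, col M l]"] by (simp add: numeral_2_eq_2)
    have "{col M j, col M l} \<subseteq> set (cols M)"
      using M ij by (auto simp: cols_def)
    then have "lin_dep {col M j, col M l}"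
      using rank_ge_card_indpt[OF M, of "{col M j, col M l}"] rank False by auto
    then obtain v where v: "v \<in> carrier_vec 2" "v \<noteq> 0\<^sub>v 2" "?N *\<^sub>v v = 0\<^sub>v n"
      using lin_depE[OF N] cols False by auto
    have "(?N *\<^sub>v v) $ r = M $$ (r,j) * v $ 0 + M $$ (r,l) * v $ 1" if "r < n" for r
      using v(1) that M ij by (simp add: scalar_prod_def mat_of_cols_def eval_nat_numeral)
    then have rel: "M $$ (r,j) * v $ 0 + M $$ (r,l) * v $ 1 = 0" if "r < n" for r
      using v(3) that by simp
    have "v $ 0 \<noteq> 0 \<or> v $ 1 \<noteq> 0"
    proof (rule ccontr)
      assume "\<not> ?thesis"
      then have "v = 0\<^sub>v 2" using v(1) by (intro eq_vecI) (auto simp: less_2_cases_iff)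
      then show False using v(2) by simp
    qed
    then show ?thesis using det2_eq_0[OF rel[OF ij(1)] rel[OF ij(2)]] by simp
  qed
qed

text \<open>Rank one means that \<open>t - 1\<close> sends \<open>x\<close> to
  \<open>qscale (\<phi> x) u\<close> for a linear form \<open>\<phi>\<close>, and invariance of the
  symplectic form forces \<open>\<phi>\<close> to be a multiple of the pairing with
  \<open>u\<close>.\<close>

lemma transvection_obtain:
  assumes two: "(2::'a::field) \<noteq> 0" and t: "t \<in> carrier (Sp4 :: 'a mat monoid)" "transvection t"
  obtains u c where "u \<noteq> 0" "c \<noteq> 0" "\<And>x. qapply t x = x + qscale (c * qform x u) u"
proof -
  interpret symplectic_space4 "qscale :: 'a \<Rightarrow> _" qform by (rule symplectic_space4_quad[OF two])
  have t4: "t \<in> carrier_mat 4 4" using t(1) by (simp add: Sp4_simps)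
  define M where "M = t - 1\<^sub>m 4"
  have M: "M \<in> carrier_mat 4 4" unfolding M_def using t4 by (intro minus_carrier_mat) auto
  have "t \<noteq> 1\<^sub>m 4" and rank: "vec_space.rank 4 M = 1" using t(2) by (simp_all add: transvection_def M_def)
  have tM: "t $$ (i,j) = (if i = j then 1 else 0) + M $$ (i,j)" if "i < 4" "j < 4" for i j
    using t4 that by (simp add: M_def)
  have "\<exists>k<4. \<exists>l<4. M $$ (k,l) \<noteq> 0"
  proof (rule ccontr)
    assume "\<not> ?thesis"
    then have "t = 1\<^sub>m 4" using t4 by (intro eq_matI) (auto simp: tM)
    then show False using \<open>t \<noteq> 1\<^sub>m 4\<close> by simp
  qed
  then obtain k l where kl: "k < 4" "l < 4" "M $$ (k,l) \<noteq> 0" by blast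
  \<comment> \<open>For a nonzero entry at \<open>(k,l)\<close>, \<open>u\<close> is column
    \<open>l\<close> and \<open>\<phi>\<close> is row \<open>k\<close> divided by that entry; the
    vanishing minors make \<open>M\<close> their product.\<close>
  define u where "u = (M $$ (0,l), M $$ (1,l), M $$ (2,l), M $$ (3,l))"
  define \<phi> where "\<phi> = (\<lambda>(x0, x1, x2, x3).
    (M $$ (k,0) * x0 + M $$ (k,1) * x1 + M $$ (k,2) * x2 + M $$ (k,3) * x3) / M $$ (k,l))"
  have "M $$ (i,j) = M $$ (i,l) * M $$ (k,j) / M $$ (k,l)" if "i < 4" "j < 4" for i j
    using rank_one_minors[OF M rank, of i k j l] that kl by (simp add: field_simps)
  then have t_entry: "t $$ (i,j) = (if i = j then 1 else 0) + M $$ (i,l) * M $$ (k,j) / M $$ (k,l)"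
    if "i < 4" "j < 4" for i j
    using tM[OF that] that by simp
  have tx: "qapply t x = x + qscale (\<phi> x) u" for x
    by (cases x) (simp add: t_entry \<phi>_def u_def add_divide_distrib algebra_simps)
  have u0: "u \<noteq> 0" using kl by (auto simp: u_def zero_prod_def less_4_cases)
  have skew: "\<phi> x * qform u y + \<phi> y * qform x u = 0" for x y
    using qform_qapply[OF t(1), of x y] unfolding tx by (simp add: B_simps)
  obtain y where y: "qform u y \<noteq> 0" using nondegenerate[OF u0] by blast
  define c where "c = - \<phi> y / qform u y"
  have \<phi>: "\<phi> x = c * qform x u" for x
    using skew[of x y] y by (simp add: c_def field_simps eq_neg_iff_add_eq_0)
  have "c \<noteq> 0"
  proof
    assume "c = 0"
    then have "t = 1\<^sub>m 4" by (intro qapply_inject[OF t4]) (simp_all add: tx \<phi> qapply_one)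
    then show False using \<open>t \<noteq> 1\<^sub>m 4\<close> by simp
  qed
  then show thesis using that[OF u0] tx \<phi> by simp
qed

section \<open>Characteristic polynomials\<close>

lemma char_poly_matrix_entry:
  assumes "A \<in> carrier_mat n n" "i < n" "l < n"
  shows "char_poly_matrix A $$ (i,l) = pCons (- A $$ (i,l)) (if i = l then 1 else 0)"
  using assms by (simp add: char_poly_matrix_def)

text \<open>The coefficient matrices of the adjugate of \<open>X - A\<close>; they satisfy Horner's recursion
  because \<open>(X - A) adj(X - A) = P\<close>.\<close>

lemma char_poly_horner:
  fixes A :: "'a::comm_ring_1 mat"
  assumes A: "A \<in> carrier_mat n n"
  obtains M N where "\<And>k. M k \<in> carrier_mat n n"
    "A * M 0 = - (poly.coeff (char_poly A) 0 \<cdot>\<^sub>m 1\<^sub>m n)"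
    "\<And>k. A * M (Suc k) = M k - poly.coeff (char_poly A) (Suc k) \<cdot>\<^sub>m 1\<^sub>m n"
    "\<And>k. N \<le> k \<Longrightarrow> M k = 0\<^sub>m n n"
proof
  define Y where "Y = adj_mat (char_poly_matrix A)"
  define M where "M k = map_mat (\<lambda>p. poly.coeff p k) Y" for k
  have C: "char_poly_matrix A \<in> carrier_mat n n" using A by simp
  have Y: "Y \<in> carrier_mat n n" "char_poly_matrix A * Y = char_poly A \<cdot>\<^sub>m 1\<^sub>m n"
    using adj_mat(1,2)[OF C] by (simp_all add: Y_def char_poly_def)
  show M: "M k \<in> carrier_mat n n" for k using Y(1) by (simp add: M_def)
  have entry: "(\<Sum>l<n. pCons (- A $$ (i,l)) (if i = l then 1 else 0) * Y $$ (l,j)) =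
      (if i = j then char_poly A else 0)" if "i < n" "j < n" for i j
  proof -
    have "(char_poly_matrix A * Y) $$ (i,j) = (\<Sum>l<n. char_poly_matrix A $$ (i,l) * Y $$ (l,j))"
      using that C Y(1) by (simp add: scalar_prod_def lessThan_atLeast0)
    also have "\<dots> = (\<Sum>l<n. pCons (- A $$ (i,l)) (if i = l then 1 else 0) * Y $$ (l,j))"
      by (intro sum.cong) (simp_all add: char_poly_matrix_entry[OF A] that)
    finally have "(char_poly A \<cdot>\<^sub>m 1\<^sub>m n) $$ (i,j) = \<dots>" unfolding Y(2) .
    moreover have "(char_poly A \<cdot>\<^sub>m 1\<^sub>m n) $$ (i,j) = (if i = j then char_poly A else 0)"
      using that by simp
    ultimately show ?thesis by (rule trans[OF sym])
  qed
  have AM: "(A * M k) $$ (i,j) = (\<Sum>l<n. A $$ (i,l) * poly.coeff (Y $$ (l,j)) k)" if "i < n" "j < n" for i j k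
    using that A M[of k] Y(1) by (simp add: scalar_prod_def lessThan_atLeast0 M_def)
  show "A * M 0 = - (poly.coeff (char_poly A) 0 \<cdot>\<^sub>m 1\<^sub>m n)"
  proof (rule eq_matI)
    fix i j assume "i < dim_row (- (poly.coeff (char_poly A) 0 \<cdot>\<^sub>m 1\<^sub>m n))" "j < dim_col (- (poly.coeff (char_poly A) 0 \<cdot>\<^sub>m 1\<^sub>m n))"
    then have ij: "i < n" "j < n" by simp_all
    have "poly.coeff (\<Sum>l<n. pCons (- A $$ (i,l)) (if i = l then 1 else 0) * Y $$ (l,j)) 0 =
        (if i = j then poly.coeff (char_poly A) 0 else 0)"
      unfolding entry[OF ij] by simp
    then have "- (A * M 0) $$ (i,j) = (if i = j then poly.coeff (char_poly A) 0 else 0)"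
      using ij by (simp add: AM coeff_sum sum_negf)
    from arg_cong[OF this, of uminus]
    show "(A * M 0) $$ (i,j) = (- (poly.coeff (char_poly A) 0 \<cdot>\<^sub>m 1\<^sub>m n)) $$ (i,j)"
      using ij by simp
  qed (use A M[of 0] in auto)
  show "A * M (Suc k) = M k - poly.coeff (char_poly A) (Suc k) \<cdot>\<^sub>m 1\<^sub>m n" for k
  proof (rule eq_matI)
    fix i j assume "i < dim_row (M k - poly.coeff (char_poly A) (Suc k) \<cdot>\<^sub>m 1\<^sub>m n)" "j < dim_col (M k - poly.coeff (char_poly A) (Suc k) \<cdot>\<^sub>m 1\<^sub>m n)"
    then have ij: "i < n" "j < n" by simp_all
    have "poly.coeff (\<Sum>l<n. pCons (- A $$ (i,l)) (if i = l then 1 else 0) * Y $$ (l,j)) (Suc k) =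
        (if i = j then poly.coeff (char_poly A) (Suc k) else 0)"
      unfolding entry[OF ij] by simp
    moreover have "poly.coeff (pCons (- A $$ (i,l)) (if i = l then 1 else 0) * Y $$ (l,j)) (Suc k) =
        (if l = i then poly.coeff (Y $$ (l,j)) k else 0) - A $$ (i,l) * poly.coeff (Y $$ (l,j)) (Suc k)" for l
      by (simp add: mult_pCons_left)
    ultimately have "poly.coeff (Y $$ (i,j)) k - (A * M (Suc k)) $$ (i,j) =
        (if i = j then poly.coeff (char_poly A) (Suc k) else 0)"
      using ij by (simp add: AM coeff_sum sum_subtractf)
    then show "(A * M (Suc k)) $$ (i,j) = (M k - poly.coeff (char_poly A) (Suc k) \<cdot>\<^sub>m 1\<^sub>m n) $$ (i,j)"
      using ij Y(1) by (simp add: M_def algebra_simps split: if_splits)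
  qed (use A M[of "Suc k"] in auto)
  \<comment> \<open>One more than all degrees of entries of \<open>Y\<close>;
    \<open>insert 0\<close> keeps the set nonempty for \<open>n = 0\<close>.\<close>
  define N where "N = Suc (Max (insert 0 ((\<lambda>(i,j). Polynomial.degree (Y $$ (i,j))) ` ({..<n} \<times> {..<n}))))"
  show "M k = 0\<^sub>m n n" if "N \<le> k" for k
  proof (rule eq_matI)
    fix i j assume "i < dim_row (0\<^sub>m n n :: 'a mat)" "j < dim_col (0\<^sub>m n n :: 'a mat)"
    then have ij: "i < n" "j < n" by simp_all
    have "Polynomial.degree (Y $$ (i,j)) \<le> Max (insert 0 ((\<lambda>(i,j). Polynomial.degree (Y $$ (i,j))) ` ({..<n} \<times> {..<n})))"
      using ij by (intro Max_ge) auto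
    then have "Polynomial.degree (Y $$ (i,j)) < k" using that by (simp add: N_def)
    then show "M k $$ (i,j) = 0\<^sub>m n n $$ (i,j)" using ij Y(1) by (simp add: M_def coeff_eq_0)
  qed (use M[of k] in auto)
qed

lemma qscale_simps:
  "qscale (a + b) x = qscale a x + qscale b x" "qscale (a - b) x = qscale a x - qscale b x"
  "qscale (- a) x = - qscale a x" "qscale a (x + y) = qscale a x + qscale a y"
  "qscale a (x - y) = qscale a x - qscale a y" "qscale a (qscale b x) = qscale (a * b) x"
  "qscale 0 x = 0" "qscale 1 x = x" "qscale a 0 = 0"
  for a b :: "'a::comm_ring_1"
  by (cases x; cases y; simp add: algebra_simps zero_prod_def)+

lemma qapply_diff: "qapply A (x - y) = qapply A x - qapply A y"
  by (cases x; cases y) (simp add: algebra_simps)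

lemma qapply_zero: "qapply A 0 = 0"
  by (simp add: zero_prod_def)

lemma qapply_power_add: "(qapply A ^^ k) (x + y) = (qapply A ^^ k) x + (qapply A ^^ k) y"
  by (induction k) (simp_all add: qapply_add)

lemma qapply_power_scale: "(qapply A ^^ k) (qscale c x) = qscale c ((qapply A ^^ k) x)"
  by (induction k) (simp_all add: qapply_scale)

text \<open>Horner's recursion makes the sum telescope: up to index \<open>m\<close> it is
  \<open>- (qapply A ^^ Suc m) (b m)\<close>, and \<open>b m\<close> vanishes for large
  \<open>m\<close>.\<close>

lemma cayley_hamilton_quad:
  fixes A :: "'a::comm_ring_1 mat"
  assumes A: "A \<in> carrier_mat 4 4"
  shows "(\<Sum>k\<le>4. qscale (poly.coeff (char_poly A) k) ((qapply A ^^ k) x)) = 0"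
proof -
  obtain M N where M: "\<And>k. M k \<in> carrier_mat 4 4"
    "A * M 0 = - (poly.coeff (char_poly A) 0 \<cdot>\<^sub>m 1\<^sub>m 4)"
    "\<And>k. A * M (Suc k) = M k - poly.coeff (char_poly A) (Suc k) \<cdot>\<^sub>m 1\<^sub>m 4"
    "\<And>k. N \<le> k \<Longrightarrow> M k = 0\<^sub>m 4 4"
    using char_poly_horner[OF A] by blast
  define c where "c = poly.coeff (char_poly A)"
  define b where "b k = qapply (M k) x" for k
  have b0: "qscale (c 0) x = - qapply A (b 0)"
    unfolding b_def qapply_mult[OF A M(1), symmetric] M(2) by (cases x) (simp add: c_def)
  have b_Suc: "qscale (c (Suc k)) x = b k - qapply A (b (Suc k))" for k
    unfolding b_def qapply_mult[OF A M(1), symmetric] M(3)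
    using M(1)[of k] by (cases x) (simp add: c_def algebra_simps)
  have b_large: "b k = 0" if "N \<le> k" for k
    unfolding b_def M(4)[OF that] by (cases x) (simp add: zero_prod_def)
  have partial: "(\<Sum>k\<le>m. qscale (c k) ((qapply A ^^ k) x)) = - (qapply A ^^ Suc m) (b m)" for m
  proof (induction m)
    case 0
    then show ?case by (simp add: b0)
  next
    case (Suc m)
    have "qscale (c (Suc m)) ((qapply A ^^ Suc m) x) = (qapply A ^^ Suc m) (b m - qapply A (b (Suc m)))"
      unfolding b_Suc[symmetric] qapply_power_scale ..
    also have "\<dots> = (qapply A ^^ Suc m) (b m) - (qapply A ^^ Suc m) (qapply A (b (Suc m)))"
      using qapply_power_add[of "Suc m" A "b m - qapply A (b (Suc m))" "qapply A (b (Suc m))"]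
      by (simp add: algebra_simps)
    finally show ?case using Suc.IH by (simp add: funpow_swap1)
  qed
  \<comment> \<open>The polynomial has degree 4, so extending the sum to where \<open>b\<close>
    vanishes adds only zeros.\<close>
  have "(\<Sum>k\<le>4. qscale (c k) ((qapply A ^^ k) x)) = (\<Sum>k\<le>max 4 N. qscale (c k) ((qapply A ^^ k) x))"
  proof (rule sum.mono_neutral_left)
    show "\<forall>k\<in>{..max 4 N} - {..4}. qscale (c k) ((qapply A ^^ k) x) = 0"
      using degree_monic_char_poly[OF A] by (auto simp: c_def coeff_eq_0 qscale_simps)
  qed auto
  also have "\<dots> = - (qapply A ^^ Suc (max 4 N)) 0"
    unfolding partial by (simp add: b_large)
  also have "(qapply A ^^ k) 0 = 0" for k by (induction k) (simp_all add: qapply_zero)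
  finally show ?thesis by (simp add: c_def)
qed

section \<open>Roots of the characteristic polynomial of a symplectic matrix\<close>

lemma char_poly_Sp4_coeff_0:
  assumes "A \<in> carrier (Sp4 :: 'a::field mat monoid)"
  shows "poly.coeff (char_poly A) 0 \<noteq> 0"
proof
  have A: "A \<in> carrier_mat 4 4" using assms by (simp add: Sp4_simps)
  obtain A' where A': "A' \<in> carrier_mat 4 4" "A' * A = 1\<^sub>m 4"
    using Sp4_left_inverse[OF assms] by (auto simp: Sp4_simps)
  assume "poly.coeff (char_poly A) 0 = 0"
  then have "eigenvalue A 0" by (simp add: eigenvalue_root_char_poly[OF A] poly_0_coeff_0)
  then obtain v where v: "v \<in> carrier_vec 4" "v \<noteq> 0\<^sub>v 4" "A *\<^sub>v v = 0 \<cdot>\<^sub>v v"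
    using A by (auto simp: eigenvalue_def eigenvector_def)
  have "v = (A' * A) *\<^sub>v v" using v(1) by (simp add: A')
  also have "\<dots> = A' *\<^sub>v (A *\<^sub>v v)" using assoc_mult_mat_vec[OF A'(1) A v(1)] .
  also have "A *\<^sub>v v = 0\<^sub>v 4" unfolding v(3) using v(1) by (intro eq_vecI) auto
  also have "A' *\<^sub>v 0\<^sub>v 4 = 0\<^sub>v 4" using A'(1) by (intro eq_vecI) auto
  finally show False using v(2) by simp
qed

lemma reciprocal_roots_char_poly:
  assumes A: "A \<in> carrier (Sp4 :: 'a::field mat monoid)" and roots: "reciprocal_roots (char_poly A) \<alpha> \<beta>"
  shows "\<alpha> \<noteq> 0" "\<beta> \<noteq> 0" "poly (map_poly to_ac (char_poly A)) \<alpha> = 0"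
    "poly (map_poly to_ac (char_poly A)) \<beta> = 0"
    "map_poly to_ac (char_poly A) = [:1, - (\<alpha> + 1 / \<alpha>), 1:] * [:1, - (\<beta> + 1 / \<beta>), 1:]"
proof -
  define P where "P = map_poly to_ac (char_poly A)"
  have "A \<in> carrier_mat 4 4" using A by (simp add: Sp4_simps)
  note monic = degree_monic_char_poly[OF this]
  have P_coeff: "poly.coeff P k = to_ac (poly.coeff (char_poly A) k)" for k by (simp add: P_def coeff_map_poly)
  have "Polynomial.degree P = 4" unfolding P_def by (subst degree_map_poly) (use monic in auto)
  then have "Polynomial.lead_coeff P = 1" using monic by (simp add: P_coeff)
  then have P_ne: "P \<noteq> 0" by auto
  obtain R where R: "P = (\<Prod>r\<in>#R. [:- r, 1:])"
    using alg_closed_imp_factorization[OF P_ne] \<open>Polynomial.lead_coeff P = 1\<close> by auto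
  have "(\<Prod>r\<in>#R. [:- r, 1:]) \<noteq> 0" for R :: "'a alg_closure multiset"
    by (auto simp: prod_mset_zero_iff)
  then have "proots (\<Prod>r\<in>#R. [:- r, 1:]) = R"
    by (induction R) (simp_all add: proots_mult del: mult_pCons_left)
  then have R_eq: "R = {#\<alpha>, 1 / \<alpha>, \<beta>, 1 / \<beta>#}"
    using roots R by (simp add: reciprocal_roots_def P_def)
  \<comment> \<open>As \<open>1 / 0 = 0\<close>, the definition of \<open>reciprocal_roots\<close>
    by itself would admit zero for \<alpha> or \<beta>; the nonzero constant term excludes
    this.\<close>
  have P0: "poly P 0 \<noteq> 0" using char_poly_Sp4_coeff_0[OF A] by (simp add: poly_0_coeff_0 P_coeff)
  have "poly P 0 = 0" if "\<alpha> = 0 \<or> \<beta> = 0" using that unfolding R R_eq by auto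
  then show ab: "\<alpha> \<noteq> 0" "\<beta> \<noteq> 0" using P0 by blast+
  show "poly (map_poly to_ac (char_poly A)) \<alpha> = 0" "poly (map_poly to_ac (char_poly A)) \<beta> = 0"
    unfolding P_def[symmetric] R R_eq by (simp_all del: mult_pCons_left mult_pCons_right)
  have "[:- r, 1:] * [:- (1 / r), 1:] = [:1, - (r + 1 / r), 1:]" if "r \<noteq> 0" for r :: "'a alg_closure"
    using that by simp
  from this[OF ab(1)] this[OF ab(2)]
  show "map_poly to_ac (char_poly A) = [:1, - (\<alpha> + 1 / \<alpha>), 1:] * [:1, - (\<beta> + 1 / \<beta>), 1:]"
    unfolding P_def[symmetric] R R_eq by (simp only: image_mset_add_mset prod_mset.add_mset image_mset_empty
      prod_mset.empty mult_1_right mult.assoc[symmetric])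
qed

lemma add_reciprocal_eq:
  fixes x y :: "'a::field"
  assumes "x \<noteq> 0" "y \<noteq> 0" and eq: "x + 1 / x = y + 1 / y"
  shows "x = y \<or> x = 1 / y"
proof -
  have "(x - y) * (x * y - 1) = x * y * ((x + 1 / x) - (y + 1 / y))"
    using assms(1,2) by (simp add: algebra_simps)
  then have "(x - y) * (x * y - 1) = 0" unfolding eq by simp
  then have "x = y \<or> x * y = 1" by simp
  then show ?thesis using assms(2) by (auto simp: eq_divide_eq)
qed

lemma to_ac_comm_ring_hom: "comm_ring_hom to_ac"
  by standard simp_all

lemma Sp4_inverse:
  assumes "A \<in> carrier (Sp4 :: 'a::field mat monoid)"
  obtains A' where "A' \<in> carrier_mat 4 4" "A * A' = 1\<^sub>m 4" "A' * A = 1\<^sub>m 4"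
proof -
  have A: "A \<in> carrier_mat 4 4" using assms by (simp add: Sp4_simps)
  obtain A' where A': "A' \<in> carrier_mat 4 4" "A' * A = 1\<^sub>m 4"
    using Sp4_left_inverse[OF assms] by (auto simp: Sp4_simps)
  then show thesis using that mat_mult_left_right_inverse[OF A'(1) A] by blast
qed

text \<open>Comparing coefficients shows the characteristic polynomial to be
  \<open>X^4 - p X^3 + (q + 2) X^2 - p X + 1\<close>. Dividing the Cayley-Hamilton equation by
  \<open>X^2\<close>, that is, applying it at \<open>h (h x)\<close>, gives the quadratic equation
  of \<open>A + h\<close>, whose discriminant is \<open>Delta0\<close>. The left side of the last
  claim is the square of \<open>A + h\<close> at \<open>x\<close>.\<close>

lemma sum_inverse_quadratic:
  fixes A :: "'a::field mat"
  assumes A: "A \<in> carrier Sp4" and roots: "reciprocal_roots (char_poly A) \<alpha> \<beta>"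
    and h: "\<And>x. qapply A (h x) = x" "\<And>x. h (qapply A x) = x"
  obtains p q where "to_ac p = (\<alpha> + 1 / \<alpha>) + (\<beta> + 1 / \<beta>)" "to_ac q = (\<alpha> + 1 / \<alpha>) * (\<beta> + 1 / \<beta>)"
    "Delta0 (char_poly A) = p\<^sup>2 - 4 * q"
    "\<And>x. qapply A (qapply A x) + x + x + h (h x) = qscale p (qapply A x + h x) - qscale q x"
proof -
  define p where "p = - poly.coeff (char_poly A) 3"
  define q where "q = poly.coeff (char_poly A) 2 - 2"
  note P = reciprocal_roots_char_poly(5)[OF A roots]
  have P_coeff: "to_ac (poly.coeff (char_poly A) k) =
      poly.coeff ([:1, - (\<alpha> + 1 / \<alpha>), 1:] * [:1, - (\<beta> + 1 / \<beta>), 1:]) k" for k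
    unfolding P[symmetric] by (simp add: coeff_map_poly)
  have c: "to_ac (poly.coeff (char_poly A) 0) = to_ac 1"
    "to_ac (poly.coeff (char_poly A) 1) = - ((\<alpha> + 1 / \<alpha>) + (\<beta> + 1 / \<beta>))"
    "to_ac (poly.coeff (char_poly A) 2) = 2 + (\<alpha> + 1 / \<alpha>) * (\<beta> + 1 / \<beta>)"
    "to_ac (poly.coeff (char_poly A) 3) = - ((\<alpha> + 1 / \<alpha>) + (\<beta> + 1 / \<beta>))"
    "to_ac (poly.coeff (char_poly A) 4) = to_ac 1"
    unfolding P_coeff by (simp_all add: eval_nat_numeral algebra_simps)
  have "to_ac (poly.coeff (char_poly A) 1) = to_ac (poly.coeff (char_poly A) 3)" using c by simp
  then have c': "poly.coeff (char_poly A) 0 = 1" "poly.coeff (char_poly A) 1 = - p"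
    "poly.coeff (char_poly A) 2 = q + 2" "poly.coeff (char_poly A) 3 = - p" "poly.coeff (char_poly A) 4 = 1"
    using c(1,5) by (simp_all only: to_ac_eq_iff p_def q_def) simp_all
  show thesis
  proof
    show "to_ac p = (\<alpha> + 1 / \<alpha>) + (\<beta> + 1 / \<beta>)" "to_ac q = (\<alpha> + 1 / \<alpha>) * (\<beta> + 1 / \<beta>)"
      using c by (simp_all add: p_def q_def)
    show "Delta0 (char_poly A) = p\<^sup>2 - 4 * q" by (simp add: Delta0_def c')
    fix x
    have A4: "A \<in> carrier_mat 4 4" using A by (simp add: Sp4_simps)
    have "{..4::nat} = {0, 1, 2, 3, 4}" by auto
    then have "qscale 1 (h (h x)) + qscale (- p) (h x) + qscale (q + 2) x + qscale (- p) (qapply A x) +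
        qscale 1 (qapply A (qapply A x)) = 0"
      using cayley_hamilton_quad[OF A4, of "h (h x)"] c' h by (simp add: eval_nat_numeral add.assoc)
    then show "qapply A (qapply A x) + x + x + h (h x) = qscale p (qapply A x + h x) - qscale q x"
      using qscale_simps(1)[of 1 1 x] by (simp add: qscale_simps algebra_simps)
  qed
qed

lemma qapply_add_mat:
  "A \<in> carrier_mat 4 4 \<Longrightarrow> C \<in> carrier_mat 4 4 \<Longrightarrow> qapply (A + C) x = qapply A x + qapply C x"
  by (cases x) (simp add: algebra_simps)

lemma qapply_smult_mat:
  "A \<in> carrier_mat 4 4 \<Longrightarrow> qapply (c \<cdot>\<^sub>m A) x = qscale c (qapply A x)"
  by (cases x) (simp add: algebra_simps)

text \<open>If \<open>A + h\<close> is the scalar \<open>s\<close>, then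
  \<open>A * A + 1 = s A\<close>; on an eigenvector for \<open>r\<close> over the algebraic closure
  this reads \<open>r * r + 1 = s r\<close>. It serves to show that both roots of the quadratic
  equation for \<open>g2\<close> occur as eigenvalues.\<close>

lemma scalar_sum_inverse:
  fixes A :: "'a::field mat"
  assumes A: "A \<in> carrier_mat 4 4" and h: "\<And>x. h (qapply A x) = x"
    and scalar: "\<And>x. qapply A x + h x = qscale s x"
    and r: "poly (map_poly to_ac (char_poly A)) r = 0" "r \<noteq> 0"
  shows "r + 1 / r = to_ac s"
proof -
  interpret comm_ring_hom to_ac by (rule to_ac_comm_ring_hom)
  define K where "K = map_mat to_ac A"
  have K: "K \<in> carrier_mat 4 4" using A by (simp add: K_def)
  have "A * A + 1\<^sub>m 4 = s \<cdot>\<^sub>m A"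
  proof (rule qapply_inject)
    fix x
    show "qapply (A * A + 1\<^sub>m 4) x = qapply (s \<cdot>\<^sub>m A) x"
      using scalar[of "qapply A x"] A
      by (simp add: qapply_add_mat mult_carrier_mat[of _ 4 4] qapply_mult qapply_one qapply_smult_mat h)
  qed (use A in auto)
  then have "map_mat to_ac (A * A + 1\<^sub>m 4) = map_mat to_ac (s \<cdot>\<^sub>m A)" by simp
  moreover have "map_mat to_ac (A * A + 1\<^sub>m 4) = map_mat to_ac (A * A) + 1\<^sub>m 4"
    using A by (intro eq_matI) auto
  moreover have "map_mat to_ac (A * A) = K * K" unfolding K_def by (rule mat_hom_mult[OF A A])
  moreover have "map_mat to_ac (s \<cdot>\<^sub>m A) = to_ac s \<cdot>\<^sub>m K" unfolding K_def by (intro eq_matI) auto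
  ultimately have eq: "K * K + 1\<^sub>m 4 = to_ac s \<cdot>\<^sub>m K" by simp
  have "poly (char_poly K) r = 0" using r(1) by (simp add: K_def char_poly_hom[OF A])
  then obtain v where v: "v \<in> carrier_vec 4" "v \<noteq> 0\<^sub>v 4" "K *\<^sub>v v = r \<cdot>\<^sub>v v"
    using eigenvalue_root_char_poly[OF K] K by (auto simp: eigenvalue_def eigenvector_def)
  obtain i where i: "i < 4" "v $ i \<noteq> 0" using v(1,2) by (metis carrier_vecD eq_vecI index_zero_vec)
  have "(K * K + 1\<^sub>m 4) *\<^sub>v v = K *\<^sub>v (K *\<^sub>v v) + v"
    using K v(1) by (simp add: add_mult_distrib_mat_vec[of _ 4 4] assoc_mult_mat_vec[of _ 4 4 _ 4] mult_carrier_mat[of _ 4 4])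
  also have "\<dots> = r \<cdot>\<^sub>v (r \<cdot>\<^sub>v v) + v" using K v by (simp add: mult_mat_vec[of _ 4 4])
  finally have "((K * K + 1\<^sub>m 4) *\<^sub>v v) $ i = (r * r + 1) * v $ i" using i v(1) by (simp add: algebra_simps)
  moreover have "((to_ac s \<cdot>\<^sub>m K) *\<^sub>v v) $ i = to_ac s * (K *\<^sub>v v) $ i"
    using K v(1) i by simp
  then have "((to_ac s \<cdot>\<^sub>m K) *\<^sub>v v) $ i = to_ac s * r * v $ i" using v i by simp
  ultimately have "r * r + 1 = to_ac s * r" using i(2) by (simp add: eq)
  then show ?thesis using r(2) by (simp add: field_simps)
qed

text \<open>The powers of the given transvection have coefficients \<open>of_nat n * c\<close>, and
  over a prime field these exhaust all scalars, since \<open>c\<close> is nonzero.\<close>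

lemma centers_nonempty:
  fixes G :: "'l::prime_card mod_ring mat set"
  assumes two: "(2::'l mod_ring) \<noteq> 0" and G: "subgroup G Sp4" and t: "t \<in> G" "transvection t"
  shows "isometry_group.centers qscale qform (qapply ` G) \<noteq> {}"
proof -
  interpret isometry_group qscale qform "qapply ` G" by (rule isometry_group_Sp4_subgroup[OF two G])
  obtain u c where u: "u \<noteq> 0" "c \<noteq> 0" "\<And>x. qapply t x = x + qscale (c * qform x u) u"
    using transvection_obtain[OF two subgroup.mem_carrier[OF G t(1)] t(2)] by blast
  have t_eq: "qapply t = transvec u c" by (rule ext) (simp add: u(3) transvec_def)
  have power: "transvec u (of_nat n * c) \<in> qapply ` G" for n
  proof (induction n)
    case 0
    have "transvec u (of_nat 0 * c) = id" by (rule ext) (simp add: transvec_def)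
    then show ?case using id_in_G by metis
  next
    case (Suc n)
    have "transvec u (of_nat (Suc n) * c) = transvec u c \<circ> transvec u (of_nat n * c)"
      by (rule ext) (simp add: transvec_def B_simps algebra_simps)
    then show ?case using comp_in_G[OF _ Suc] t(1) by (metis t_eq imageI)
  qed
  have "transvec u d \<in> qapply ` G" for d
  proof -
    obtain n where "d / c = of_nat n" using surj_of_nat_mod_ring by blast
    then have "d = of_nat n * c" using u(2) by (simp add: field_simps)
    then show ?thesis using power by simp
  qed
  then have "u \<in> centers" using u(1) by (simp add: centers_def)
  then show ?thesis by blast
qed

theorem theorem3p6:
  fixes G :: "'l :: prime_card mod_ring mat set"
    and t g1 g2 :: "'l mod_ring mat"
    and \<alpha>1 \<beta>1 \<alpha>2 \<beta>2 :: "'l mod_ring alg_closure"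
  assumes "CARD('l) \<noteq> 2"
    and "subgroup G Sp4"
    and "t \<in> G" and "transvection t"
    and "g1 \<in> G" and "reciprocal_roots (char_poly g1) \<alpha>1 \<beta>1"
    and "\<alpha>1 + 1 / \<alpha>1 \<notin> range to_ac" and "\<beta>1 + 1 / \<beta>1 \<notin> range to_ac"
    and "\<alpha>1 + 1 / \<alpha>1 + \<beta>1 + 1 / \<beta>1 \<noteq> 0"
    and "g2 \<in> G" and "reciprocal_roots (char_poly g2) \<alpha>2 \<beta>2"
    and "\<alpha>2 + 1 / \<alpha>2 \<in> range to_ac" and "\<beta>2 + 1 / \<beta>2 \<in> range to_ac"
    and "Delta0 (char_poly g2) \<noteq> 0"
    and "\<alpha>2 \<notin> range to_ac"
  shows "G = carrier Sp4"
proof -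
  have "(of_nat 2 :: 'l mod_ring) \<noteq> 0"
  proof
    assume "(of_nat 2 :: 'l mod_ring) = 0"
    then have "CARD('l) dvd 2" by (rule of_nat_0_mod_ring_dvd)
    then show False using assms(1) prime_card[where 'a = 'l] two_is_prime_nat primes_dvd_imp_eq by blast
  qed
  then have two: "(2 :: 'l mod_ring) \<noteq> 0" by simp
  note G = assms(2)
  interpret isometry_group qscale qform "qapply ` G" by (rule isometry_group_Sp4_subgroup[OF two G])
  have centers_ne: "centers \<noteq> {}" by (rule centers_nonempty[OF two G assms(3,4)])
  have g1: "g1 \<in> carrier Sp4" and g2: "g2 \<in> carrier Sp4"
    using subgroup.mem_carrier[OF G] assms(5,10) by blast+
  have g14: "g1 \<in> carrier_mat 4 4" and g24: "g2 \<in> carrier_mat 4 4" using g1 g2 by (simp_all add: Sp4_simps)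
  obtain k1 where k1: "k1 \<in> carrier_mat 4 4" "g1 * k1 = 1\<^sub>m 4" "k1 * g1 = 1\<^sub>m 4"
    by (rule Sp4_inverse[OF g1])
  obtain k2 where k2: "k2 \<in> carrier_mat 4 4" "g2 * k2 = 1\<^sub>m 4" "k2 * g2 = 1\<^sub>m 4"
    by (rule Sp4_inverse[OF g2])
  have h1: "qapply g1 (qapply k1 x) = x" "qapply k1 (qapply g1 x) = x" for x
    using qapply_mult[OF g14 k1(1), of x] qapply_mult[OF k1(1) g14, of x] by (simp_all add: k1 qapply_one)
  have h2: "qapply g2 (qapply k2 x) = x" "qapply k2 (qapply g2 x) = x" for x
    using qapply_mult[OF g24 k2(1), of x] qapply_mult[OF k2(1) g24, of x] by (simp_all add: k2 qapply_one)
  note qapply_simps = qapply_add qapply_scale h1 h2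
  obtain p q where pq: "to_ac p = (\<alpha>1 + 1 / \<alpha>1) + (\<beta>1 + 1 / \<beta>1)"
    "to_ac q = (\<alpha>1 + 1 / \<alpha>1) * (\<beta>1 + 1 / \<beta>1)"
    "\<And>x. qapply g1 (qapply g1 x) + x + x + qapply k1 (qapply k1 x) = qscale p (qapply g1 x + qapply k1 x) - qscale q x"
    using sum_inverse_quadratic[OF g1 assms(6) h1] by blast
  obtain s s' where s: "to_ac s = \<alpha>2 + 1 / \<alpha>2" "to_ac s' = \<beta>2 + 1 / \<beta>2"
    using assms(12,13) by (metis imageE)
  obtain p' q' where pq': "to_ac p' = (\<alpha>2 + 1 / \<alpha>2) + (\<beta>2 + 1 / \<beta>2)"
    "to_ac q' = (\<alpha>2 + 1 / \<alpha>2) * (\<beta>2 + 1 / \<beta>2)" "Delta0 (char_poly g2) = p'\<^sup>2 - 4 * q'"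
    "\<And>x. qapply g2 (qapply g2 x) + x + x + qapply k2 (qapply k2 x) = qscale p' (qapply g2 x + qapply k2 x) - qscale q' x"
    using sum_inverse_quadratic[OF g2 assms(11) h2] by blast
  have "to_ac p' = to_ac (s + s')" "to_ac q' = to_ac (s * s')" using pq'(1,2) s by simp_all
  then have p'q': "p' = s + s'" "q' = s * s'" by (simp_all only: to_ac_eq_iff)
  \<comment> \<open>\<open>Delta0\<close> is the discriminant of the quadratic polynomial with roots
    \<open>s\<close> and \<open>s'\<close>, so its nonvanishing separates them.\<close>
  have "Delta0 (char_poly g2) = (s - s')\<^sup>2" unfolding pq'(3) p'q' by (simp add: power2_eq_square algebra_simps)
  then have ss': "s \<noteq> s'" using assms(14) by auto
  define A where "A x = qapply g1 x + qapply k1 x" for x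
  define A' where "A' x = qapply g2 x + qapply k2 x" for x
  have A_quad: "A (A x) = qscale p (A x) + qscale (- q) x" for x
    using pq(3)[of x] by (simp add: A_def qapply_simps algebra_simps)
  have A'_quad: "A' (A' x) = qscale (s + s') (A' x) - qscale (s * s') x" for x
    using pq'(4)[of x] by (simp add: A'_def qapply_simps p'q' algebra_simps)
  have A_scale: "A (qscale c x) = qscale c (A x)" "A' (qscale c x) = qscale c (A' x)" for c x
    by (simp_all add: A_def A'_def qapply_simps qscale_simps)
  have A'_diff: "A' (x - y) = A' x - A' y" for x y by (simp add: A'_def qapply_diff)
  have p0: "p \<noteq> 0" using pq(1) assms(9) by (auto simp: add.assoc)
  \<comment> \<open>An eigenvalue \<open>m\<close> would be a root of \<open>X^2 - p X + q\<close>,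
    whose roots in the closure lie outside the base field by hypothesis.\<close>
  have no_ev1: "x = 0" if "A x = qscale m x" for x m
  proof -
    have "qscale (m * m - p * m + q) x = 0"
      using A_quad[of x] by (simp add: that A_scale qscale_simps)
    moreover have "m * m - p * m + q \<noteq> 0"
    proof
      assume "m * m - p * m + q = 0"
      then have "to_ac (m * m - p * m + q) = 0" by simp
      then have "(to_ac m - (\<alpha>1 + 1 / \<alpha>1)) * (to_ac m - (\<beta>1 + 1 / \<beta>1)) = 0"
        by (simp only: to_ac_add to_ac_diff to_ac_mult pq) (simp only: algebra_simps)
      then have "\<alpha>1 + 1 / \<alpha>1 = to_ac m \<or> \<beta>1 + 1 / \<beta>1 = to_ac m" by auto
      then show False using assms(7,8) by (metis rangeI)
    qed
    ultimately show ?thesis by simp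
  qed
  note roots2 = reciprocal_roots_char_poly[OF g2 assms(11)]
  \<comment> \<open>Without an eigenvector for \<open>s\<close>, the quadratic equation makes
    \<open>A'\<close> the scalar \<open>s'\<close>, so that every root \<open>r\<close> has
    \<open>r + 1 / r = s'\<close>, whereas \<alpha>2 gives \<open>s\<close>.\<close>
  have "\<exists>e. e \<noteq> 0 \<and> A' e = qscale s e"
  proof (rule ccontr)
    assume none: "\<not> ?thesis"
    have "A' x = qscale s' x" for x
    proof -
      have "A' (A' x - qscale s' x) = qscale s (A' x - qscale s' x)"
        by (simp add: A'_diff A_scale A'_quad qscale_simps algebra_simps)
      then have "A' x - qscale s' x = 0" using none by blast
      then show ?thesis by simp
    qed
    then have "\<alpha>2 + 1 / \<alpha>2 = to_ac s'"
      using scalar_sum_inverse[OF g24 h2(2) _ roots2(3,1)] by (simp add: A'_def)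
    then show False using s ss' by (metis to_ac_eq_iff)
  qed
  then obtain e where e: "e \<noteq> 0" "A' e = qscale s e" by blast
  have "\<exists>f. f \<noteq> 0 \<and> A' f = qscale s' f"
  proof (rule ccontr)
    assume none: "\<not> ?thesis"
    have "A' x = qscale s x" for x
    proof -
      have "A' (A' x - qscale s x) = qscale s' (A' x - qscale s x)"
        by (simp add: A'_diff A_scale A'_quad qscale_simps algebra_simps)
      then have "A' x - qscale s x = 0" using none by blast
      then show ?thesis by simp
    qed
    then have "\<beta>2 + 1 / \<beta>2 = to_ac s"
      using scalar_sum_inverse[OF g24 h2(2) _ roots2(4,2)] by (simp add: A'_def)
    then show False using s ss' by (metis to_ac_eq_iff)
  qed
  then obtain f where f: "f \<noteq> 0" "A' f = qscale s' f" by blast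
  \<comment> \<open>An eigenvalue \<open>m\<close> of \<open>g2\<close> at such an \<open>x\<close>
    satisfies \<open>m + 1 / m = s\<close>, so \<alpha>2 would be \<open>m\<close> or
    \<open>1 / m\<close> and lie in the base field.\<close>
  have no_ev2: "x = 0" if x: "A' x = qscale s x" "qapply g2 x = qscale m x" for x m
  proof (rule ccontr)
    assume x0: "x \<noteq> 0"
    have "x = qapply k2 (qscale m x)" using h2(2)[of x] x(2) by simp
    then have kx: "x = qscale m (qapply k2 x)" by (simp add: qapply_scale)
    then have m0: "m \<noteq> 0" using x0 by (auto simp: qscale_simps)
    have "qapply k2 x = qscale (1 / m) x" by (subst (2) kx) (simp add: m0)
    then have "qscale (m + 1 / m - s) x = 0" using x by (simp add: A'_def qscale_simps)
    then have "s = m + 1 / m" using x0 by simp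
    then have "\<alpha>2 + 1 / \<alpha>2 = to_ac m + 1 / to_ac m" using s(1) by simp
    moreover have "to_ac m \<noteq> 0" using m0 by simp
    ultimately have "\<alpha>2 = to_ac m \<or> \<alpha>2 = 1 / to_ac m"
      using add_reciprocal_eq[OF roots2(1)] by blast
    then have "\<alpha>2 = to_ac m \<or> \<alpha>2 = to_ac (1 / m)" by simp
    then show False using assms(15) by blast
  qed
  have g_in: "qapply g1 \<in> qapply ` G" "qapply g2 \<in> qapply ` G" using assms(5,10) by blast+
  have "Y \<in> G" if Y: "Y \<in> carrier Sp4" for Y
  proof -
    have Y4: "Y \<in> carrier_mat 4 4" using Y by (simp add: Sp4_simps)
    have iso: "isometry (qapply Y)" by (simp add: isometry_def qapply_add qapply_scale qform_qapply[OF Y])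
    have "qapply Y \<in> qapply ` G"
    proof (rule all_isometries[where ?g1.0 = "qapply g1" and ?h1.0 = "qapply k1" and \<tau> = p and \<nu> = "- q"
          and ?g2.0 = "qapply g2" and ?h2.0 = "qapply k2" and s = s and s' = s' and e = e and f = f
          and v = "(1, 0, 0, 0)" and w = "(0, 0, 1, 0)" and p = "(0, 1, 0, 0)" and q = "(0, 0, 0, 1)",
          OF centers_ne g_in(1) h1(2,1) _ _ p0 g_in(2) h2(2,1) _ ss' e(1) _ f(1)])
      show "x = 0" if "qapply g1 x + qapply k1 x = qscale m x" for x m
        using no_ev1 that unfolding A_def .
      show "let A = \<lambda>x. qapply g1 x + qapply k1 x in A (A x) = qscale p (A x) + qscale (- q) x" for x
        using A_quad[of x] unfolding A_def Let_def .
      show "let A = \<lambda>x. qapply g2 x + qapply k2 x in A (A x) = qscale (s + s') (A x) - qscale (s * s') x" for x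
        using A'_quad[of x] unfolding A'_def Let_def .
      show "qapply g2 e + qapply k2 e = qscale s e" "qapply g2 f + qapply k2 f = qscale s' f"
        using e(2) f(2) unfolding A'_def .
      show "x = 0" if "qapply g2 x + qapply k2 x = qscale s x" "qapply g2 x = qscale m x" for x m
        using no_ev2 that unfolding A'_def by blast
    qed (use iso in simp_all)
    then obtain C where C: "C \<in> G" "qapply Y = qapply C" by blast
    have "C \<in> carrier_mat 4 4" using subgroup.mem_carrier[OF G C(1)] by (simp add: Sp4_simps)
    then have "Y = C" using qapply_inject[OF Y4] C(2) by simp
    then show ?thesis using C(1) by simp
  qed
  then show ?thesis using subgroup.subset[OF G] by blast
qed

end
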